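(* Let $d>0$ be fixed, let $N$ be the number of triangles in $G_n=\mathcal{G}(n,\frac dn)$, and let $k=k_n$ be a sequence of positive integers which is (weakly) increasing in $n$. Let $0<\mu<\frac1{10}$ be fixed and suppose $k\le n^{\frac1{10}-\mu}$. For a constant $0<\varepsilon<1$ define the events $$\mathcal{D}_\varepsilon:=\{\text{there exist at least }(1-\varepsilon)k\text{ vertex-disjoint triangles in }G_n\},$$ $$\mathcal{C}_\varepsilon:=\{\text{there exists }V'\subseteq V_n\text{ such that }|V'|\le(1+\varepsilon)6^{1/3}k^{1/3}\text{ and }\Delta(V')\ge(1-\varepsilon)k\}.$$ Then, for any constant $0<\varepsilon<1$, $$\lim_{n\to\infty}\mathbb{P}(\mathcal{D}_\varepsilon\cup\mathcal{C}_\varepsilon\mid N\ge k)=1.$$ Moreover, let $\delta>0$ be a sufficiently small constant. If $k^{1/3}\log k<\big((\frac3{\sqrt2})^{2/3}-\delta\big)\log n$, then $$\lim_{n\to\infty}\mathbb{P}(\mathcal{D}_\varepsilon\mid N\ge k)=1,$$ and if $k^{1/3}\log k>\big((\frac3{\sqrt2})^{2/3}+\delta\big)\log n$, then $$\lim_{n\to\infty}\mathbb{P}(\mathcal{C}_\varepsilon\mid N\ge k)=1.$$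
   Context: $\mathcal{G}(n,p)$ denotes the Erdős–Rényi random graph on $n$ vertices, in which each of the $\binom n2$ possible edges is present independently with probability $p$ (here $p=d/n$, with $n$ large enough that $d/n\le1$). $V_n$ is the vertex set of $G_n$. $N$ counts unordered triples of vertices all of whose three pairs are edges. For $W\subseteq V_n$, $\Delta(W)$ is the number of triangles of $G_n$ all of whose vertices lie in $W$. $\log$ is the natural logarithm. *)

theory Defs
  imports "HOL-Probability.Probability"
begin

text \<open>A graph on the vertex set \<open>{..<n}\<close> is represented by its set of edges, an edge being a
  two-element set of vertices.\<close>

definition potential_edges :: "nat \<Rightarrow> nat set set" where
  "potential_edges n = {e. e \<subseteq> {..<n} \<and> card e = 2}"

text \<open>The parameter is meant to satisfy \<open>0 \<le> p \<le> 1\<close>; \<open>bernoulli_pmf\<close> truncates it to this range,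
  so with \<open>p = d / n\<close> only finitely many \<open>n\<close> are affected.\<close>

definition gnp :: "nat \<Rightarrow> real \<Rightarrow> nat set set pmf" where
  "gnp n p = map_pmf (\<lambda>x. {e \<in> potential_edges n. x e})
     (Pi_pmf (potential_edges n) False (\<lambda>_. bernoulli_pmf p))"

definition triangles :: "nat set set \<Rightarrow> nat set \<Rightarrow> nat set set" where
  "triangles E W = {T. T \<subseteq> W \<and> card T = 3 \<and> (\<forall>u\<in>T. \<forall>v\<in>T. u \<noteq> v \<longrightarrow> {u, v} \<in> E)}"

definition num_triangles :: "nat set set \<Rightarrow> nat set \<Rightarrow> nat" where
  "num_triangles E W = card (triangles E W)"

definition disjoint_event :: "nat \<Rightarrow> nat \<Rightarrow> real \<Rightarrow> nat set set \<Rightarrow> bool" where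
  "disjoint_event n k \<epsilon> E \<longleftrightarrow>
     (\<exists>F. F \<subseteq> triangles E {..<n} \<and> disjoint F \<and> real (card F) \<ge> (1 - \<epsilon>) * real k)"

definition cluster_event :: "nat \<Rightarrow> nat \<Rightarrow> real \<Rightarrow> nat set set \<Rightarrow> bool" where
  "cluster_event n k \<epsilon> E \<longleftrightarrow>
     (\<exists>V'. V' \<subseteq> {..<n} \<and>
        real (card V') \<le> (1 + \<epsilon>) * 6 powr (1/3) * real k powr (1/3) \<and>
        real (num_triangles E V') \<ge> (1 - \<epsilon>) * real k)"

end

theory Submission
  imports Defs "HOL-Real_Asymp.Real_Asymp"
begin

text \<open>The only fact about the random graph that the proof uses is that a given set \<open>S\<close> of possible edges
is present with probability \<open>p ^ card S\<close>; the rest is counting and union bounds.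

Let \<open>w = (6 k)\<^sup>1\<^sup>/\<^sup>3\<close>, the size of a clique with \<open>k\<close> triangles. Such a clique has about \<open>w\<^sup>2 / 2\<close> edges,
so its presence costs \<open>U = w\<^sup>2 / 2 * ln n\<close>, meaning that it has probability \<open>exp (- U)\<close> up to a factor
\<open>exp (o(U))\<close>. Producing \<open>k\<close> disjoint triangles has probability about \<open>(d\<^sup>3 / 6)\<^sup>k / k!\<close> and costs
\<open>k ln k\<close>. Hence \<open>P(N \<ge> k) \<ge> exp (- min U (k ln k) - o(U))\<close>, which is \<open>many_ge\<close>.

For the matching upper bound, the triangles of a graph are split into the isolated ones, which meet no
other triangle, and the linked ones. A subgraph that grows along linked triangles gains
more edges than vertices in every step, and each surplus edge costs a factor \<open>1 / n\<close>. For
\<open>k \<le> n\<^sup>1\<^sup>/\<^sup>1\<^sup>0\<close> this leaves only \<open>O(w\<^sup>2)\<close> edges in linked triangles (\<open>linked_triangles_excess\<close>,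
\<open>prob_excess_le\<close>). Deleting edges that lie in few triangles costs few triangles and leaves a core
\<open>H\<close> with \<open>O(w)\<close> vertices (\<open>core_and_disjoint_triangles\<close>). There are only \<open>exp (o(U))\<close> possible cores,
so a union bound over the core and the isolated triangles is sharp (\<open>prob_cores_le\<close>).

Suppose that the core carries a share \<open>\<tau>\<close> of the \<open>k\<close> triangles. It then has at least
\<open>\<tau>\<^sup>2\<^sup>/\<^sup>3 * w\<^sup>2 / 2\<close> edges (\<open>card_ge_of_triangles\<close>), and the other triangles are disjoint, so the cost
in units of \<open>U\<close> is at least about \<open>\<tau>\<^sup>2\<^sup>/\<^sup>3 + \<lambda> * (1 - \<tau>)\<close> with \<open>\<lambda> = k ln k / U\<close>. This is a concave
function of \<open>\<tau>\<close> with values \<open>\<lambda>\<close> and \<open>1\<close> at the ends, so a share away from both ends is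
strictly more expensive than \<open>min 1 \<lambda>\<close>, and for \<open>\<lambda>\<close> away from \<open>1\<close> only one of the ends is cheap.
If there are too few disjoint triangles then \<open>\<tau>\<close> is away from \<open>0\<close>. If there is no cluster, then either
\<open>\<tau>\<close> is away from \<open>1\<close>, or the core has by stability a constant factor more edges than the clique
(\<open>cluster_of_few_edges\<close>). The threshold \<open>\<lambda> = 1\<close> is the one of the theorem because
\<open>U = (3 / sqrt 2)\<^sup>2\<^sup>/\<^sup>3 * k\<^sup>2\<^sup>/\<^sup>3 * ln n\<close>.

These estimates need \<open>k \<rightarrow> \<infinity>\<close>. Otherwise \<open>k\<close>, being monotone, is eventually constant; then \<open>N \<ge> k\<close> has
probability bounded below while linked triangles exist with probability \<open>O(1 / n)\<close>.\<close>

section \<open>Triangles and edges of finite graphs\<close>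

definition pairs :: "nat set \<Rightarrow> nat set set" where
  "pairs A = {e. e \<subseteq> A \<and> card e = 2}"

lemma pairs_iff: "e \<in> pairs A \<longleftrightarrow> e \<subseteq> A \<and> card e = 2"
  by (simp add: pairs_def)

lemma potential_edges_eq_pairs: "potential_edges n = pairs {..<n}"
  by (simp add: potential_edges_def pairs_def)

lemma finite_pairs [simp]: "finite A \<Longrightarrow> finite (pairs A)"
  by (simp add: pairs_def)

lemma card_pairs: "finite A \<Longrightarrow> card (pairs A) = card A choose 2"
  by (simp add: pairs_def n_subsets)

lemma pairs_mono: "A \<subseteq> B \<Longrightarrow> pairs A \<subseteq> pairs B"
  by (auto simp: pairs_def)

lemma Union_pairs:
  assumes "card T = 3" shows "\<Union>(pairs T) = T"
proof -
  obtain a b c where "T = {a,b,c}" "a \<noteq> b" "b \<noteq> c" "a \<noteq> c"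
    using assms by (auto simp: card_3_iff)
  then have "{a,b} \<in> pairs T" "{b,c} \<in> pairs T" by (auto simp: pairs_def)
  moreover have "\<Union>(pairs T) \<subseteq> T" by (auto simp: pairs_def)
  ultimately show ?thesis using \<open>T = {a,b,c}\<close> by blast
qed

lemma card_pairs_3: "card T = 3 \<Longrightarrow> card (pairs T) = 3"
  by (subst card_pairs) (auto simp: card_ge_0_finite numeral_eq_Suc)

lemma triangles_iff: "T \<in> triangles E W \<longleftrightarrow> T \<subseteq> W \<and> card T = 3 \<and> pairs T \<subseteq> E"
proof -
  have "(\<forall>u\<in>T. \<forall>v\<in>T. u \<noteq> v \<longrightarrow> {u, v} \<in> E) \<longleftrightarrow> pairs T \<subseteq> E"
    by (fastforce simp: pairs_def card_2_iff)
  then show ?thesis by (auto simp: triangles_def)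
qed

lemma triangles_mono: "E \<subseteq> E' \<Longrightarrow> W \<subseteq> W' \<Longrightarrow> triangles E W \<subseteq> triangles E' W'"
  by (simp add: subset_iff triangles_iff)

lemma triangle_subset_Union: "T \<in> triangles H W \<Longrightarrow> T \<subseteq> \<Union>H"
  using Union_pairs[of T] Union_mono[of "pairs T" H] by (simp add: triangles_iff)

text \<open>Graphs are given by their edge sets, so isolated vertices do not exist and the vertex set of \<open>H\<close> is
\<open>\<Union>H\<close>.\<close>

definition graph :: "nat set set \<Rightarrow> bool" where
  "graph H \<longleftrightarrow> finite H \<and> (\<forall>e\<in>H. card e = 2)"

lemma graph_subset: "graph H \<Longrightarrow> H' \<subseteq> H \<Longrightarrow> graph H'"
  by (auto simp: graph_def intro: finite_subset)

lemma graph_finite: "graph H \<Longrightarrow> finite H" by (simp add: graph_def)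

lemma graph_finite_vertices: "graph H \<Longrightarrow> finite (\<Union>H)"
  unfolding graph_def by (metis card_ge_0_finite finite_Union zero_less_numeral)

lemma finite_triangles: "graph H \<Longrightarrow> finite (triangles H W)"
proof (rule finite_subset)
  show "triangles H W \<subseteq> Pow (\<Union>H)" using triangle_subset_Union by blast
qed (use graph_finite_vertices in auto)

lemma graph_subset_pairs: "graph H \<Longrightarrow> H \<subseteq> pairs (\<Union>H)"
  by (auto simp: graph_def pairs_def)

definition star :: "nat set set \<Rightarrow> nat \<Rightarrow> nat set set" where
  "star H v = {e \<in> H. v \<in> e}"

definition triangles_at :: "nat set set \<Rightarrow> nat \<Rightarrow> nat set set" where
  "triangles_at H v = {T \<in> triangles H UNIV. v \<in> T}"

text \<open>Double counting of incidences; used for edges (\<open>r = 2\<close>) and for triangles (\<open>r = 3\<close>).\<close>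

lemma sum_incidences:
  assumes "finite A" "finite V" "\<And>a. a \<in> A \<Longrightarrow> a \<subseteq> V \<and> card a = r"
  shows "(\<Sum>v\<in>V. card {a \<in> A. v \<in> a}) = r * card A"
proof -
  have "(\<Sum>v\<in>V. card {a \<in> A. v \<in> a}) = (\<Sum>v\<in>V. \<Sum>a\<in>A. if v \<in> a then 1 else 0)"
    using assms(1) by (simp add: sum.If_cases Int_def)
  also have "\<dots> = (\<Sum>a\<in>A. \<Sum>v\<in>V. if v \<in> a then 1 else 0)" by (rule sum.swap)
  also have "\<dots> = (\<Sum>a\<in>A. r)"
  proof (rule sum.cong[OF refl])
    fix a assume "a \<in> A"
    then have "V \<inter> {v. v \<in> a} = a" "card a = r" using assms(3) by auto
    then show "(\<Sum>v\<in>V. if v \<in> a then 1 else 0) = r" using assms(2) by (simp add: sum.If_cases)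
  qed
  finally show ?thesis by simp
qed

lemma sum_degrees: "graph H \<Longrightarrow> (\<Sum>v\<in>\<Union>H. card (star H v)) = 2 * card H"
  unfolding star_def using graph_finite_vertices graph_finite
  by (intro sum_incidences) (auto simp: graph_def)

lemma sum_triangles_at:
  "graph H \<Longrightarrow> (\<Sum>v\<in>\<Union>H. card (triangles_at H v)) = 3 * card (triangles H UNIV)"
  unfolding triangles_at_def using graph_finite_vertices finite_triangles
  by (intro sum_incidences conjI triangle_subset_Union) (auto simp: triangles_iff)

lemma inj_on_delete: "inj_on (\<lambda>T. T - {v}) {T. v \<in> T}"
  by (rule inj_onI) auto

text \<open>Deleting \<open>v\<close> from a triangle at \<open>v\<close> leaves an edge, and that edge joins two neighbours of \<open>v\<close>. The
first observation gives the bound by the number of edges, the second the one by the degree.\<close>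

lemma triangles_at_le:
  assumes "graph H"
  shows "card (triangles_at H v) \<le> card H"
    and "card (triangles_at H v) \<le> card (star H v) choose 2"
proof -
  define N where "N = {u. u \<noteq> v \<and> {v,u} \<in> H}"
  have inj: "inj_on (\<lambda>T. T - {v}) (triangles_at H v)"
    by (rule inj_on_subset[OF inj_on_delete]) (auto simp: triangles_at_def)
  have *: "T - {v} \<in> H \<inter> pairs N" if T: "T \<in> triangles_at H v" for T
  proof -
    have "card T = 3" "v \<in> T" "pairs T \<subseteq> H" using T by (auto simp: triangles_at_def triangles_iff)
    then obtain b c where Teq: "T = {v,b,c}" and d: "b \<noteq> c" "b \<noteq> v" "c \<noteq> v"
      by (auto simp: card_3_iff)
    then have "{v,b} \<in> pairs T" "{v,c} \<in> pairs T" "{b,c} \<in> pairs T" by (auto simp: pairs_def)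
    then have H: "{v,b} \<in> H" "{v,c} \<in> H" "{b,c} \<in> H" using \<open>pairs T \<subseteq> H\<close> by blast+
    have "T - {v} = {b,c}" using Teq d by auto
    moreover have "{b,c} \<subseteq> N" using H(1,2) d(2,3) by (simp add: N_def)
    moreover have "card {b,c} = 2" using d(1) by simp
    ultimately show ?thesis using H(3) by (simp add: pairs_def)
  qed
  have finN: "finite N"
    by (rule finite_subset[OF _ graph_finite_vertices[OF assms]]) (auto simp: N_def)
  have "card N = card (star H v)"
  proof (rule bij_betw_same_card[of "\<lambda>u. {v,u}"], rule bij_betwI')
    fix e assume e: "e \<in> star H v"
    then have "card e = 2" "v \<in> e" "e \<in> H" using assms by (auto simp: star_def graph_def)
    then show "\<exists>u\<in>N. e = {v, u}" by (auto simp: card_2_iff N_def insert_commute)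
  qed (auto simp: N_def star_def doubleton_eq_iff)
  moreover have "card (triangles_at H v) \<le> card (pairs N)"
    by (rule card_inj_on_le[OF inj]) (use * finN in auto)
  ultimately show "card (triangles_at H v) \<le> card (star H v) choose 2"
    using finN by (simp add: card_pairs)
  show "card (triangles_at H v) \<le> card H"
    by (rule card_inj_on_le[OF inj]) (use * graph_finite[OF assms] in auto)
qed

text \<open>The geometric mean of the two bounds of \<open>triangles_at_le\<close> is linear in the degree, and the degrees
have a known sum. This yields the sharp constant in the number of triangles without
eigenvalues. The parameter \<open>W\<close> stands for \<open>sqrt (2 * card H)\<close>, the size of a clique with that many
edges; an upper bound for it suffices.\<close>

lemma triangles_at_le_degree:
  assumes "graph H" "2 * real (card H) \<le> W\<^sup>2" "0 < W"
  shows "real (card (triangles_at H v)) \<le> W * real (card (star H v)) / 2"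
    and "real (card (triangles_at H v)) \<le> real (card (star H v)) ^ 2 / 2"
proof -
  let ?t = "real (card (triangles_at H v))" and ?d = "real (card (star H v))"
  have 1: "?t \<le> real (card H)" using triangles_at_le(1)[OF assms(1)] by simp
  have "card (star H v) choose 2 \<le> card (star H v) * card (star H v) div 2"
    by (simp add: choose_two div_le_mono)
  then have "2 * card (triangles_at H v) \<le> card (star H v) * card (star H v)"
    using triangles_at_le(2)[OF assms(1), of v] by linarith
  then have "real (2 * card (triangles_at H v)) \<le> real (card (star H v) * card (star H v))"
    by (simp only: of_nat_le_iff)
  then show 2: "?t \<le> ?d ^ 2 / 2"  by (simp add: power2_eq_square)
  show "?t \<le> W * ?d / 2"
  proof (cases "?d \<le> W")
    case True
    then have "?d ^ 2 \<le> W * ?d" by (simp add: power2_eq_square mult_right_mono)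
    then show ?thesis using 2 by simp
  next
    case False
    then have "W\<^sup>2 \<le> W * ?d" using assms(3) by (simp add: power2_eq_square)
    then show ?thesis using 1 assms(2) by simp
  qed
qed

text \<open>With \<open>W = sqrt (2 m)\<close>, where \<open>m\<close> is the number of edges, this is the bound \<open>sqrt 2 / 3 * m\<^sup>3\<^sup>/\<^sup>2\<close>, attained
asymptotically by cliques.\<close>

lemma triangle_count_le:
  assumes "graph H" "2 * real (card H) \<le> W\<^sup>2" "0 < W"
  shows "3 * real (card (triangles H UNIV)) \<le> W * real (card H)"
proof -
  have "3 * real (card (triangles H UNIV)) = (\<Sum>v\<in>\<Union>H. real (card (triangles_at H v)))"
    using arg_cong[OF sum_triangles_at[OF assms(1)], of real] by simp
  also have "\<dots> \<le> (\<Sum>v\<in>\<Union>H. W * real (card (star H v)) / 2)"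
    by (intro sum_mono triangles_at_le_degree assms)
  also have "\<dots> = W / 2 * real (\<Sum>v\<in>\<Union>H. card (star H v))"
    by (simp add: sum_distrib_left)
  finally show ?thesis using sum_degrees[OF assms(1)] by simp
qed

text \<open>Stability of \<open>triangle_count_le\<close>. A vertex of degree below \<open>(1 - \<beta>) * W\<close> loses a proportion of at
least \<open>\<beta>\<close> in the linear bound, so if the triangle count is nearly extremal then few triangles
touch such vertices. The remaining vertices have degree at least \<open>(1 - \<beta>) * W\<close>, and as the degrees
add up to at most \<open>W\<^sup>2\<close> there are at most \<open>W / (1 - \<beta>)\<close> of them.\<close>

lemma near_extremal_cluster:
  assumes "graph H" "2 * real (card H) \<le> W\<^sup>2" "0 < W" "0 < \<beta>" "\<beta> < 1"
  obtains V where "V \<subseteq> \<Union>H" "(1 - \<beta>) * real (card V) \<le> W"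
    "\<beta> * (real (card (triangles H UNIV)) - real (card (triangles H V)))
       \<le> W ^ 3 / 2 - 3 * real (card (triangles H UNIV))"
proof
  let ?t = "\<lambda>v. real (card (triangles_at H v))" and ?d = "\<lambda>v. real (card (star H v))"
  define V where "V = {v\<in>\<Union>H. ?d v \<ge> (1 - \<beta>) * W}"
  have fin: "finite (\<Union>H)" using graph_finite_vertices[OF assms(1)] .
  show sub: "V \<subseteq> \<Union>H" by (auto simp: V_def)
  have deg: "(\<Sum>v\<in>\<Union>H. ?d v) = 2 * real (card H)"
    using arg_cong[OF sum_degrees[OF assms(1)], of real] by simp
  have tri: "(\<Sum>v\<in>\<Union>H. ?t v) = 3 * real (card (triangles H UNIV))"
    using arg_cong[OF sum_triangles_at[OF assms(1)], of real] by simp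
  have "real (card V) * ((1 - \<beta>) * W) \<le> (\<Sum>v\<in>V. ?d v)"
    by (rule sum_bounded_below) (auto simp: V_def)
  also have "\<dots> \<le> (\<Sum>v\<in>\<Union>H. ?d v)" using sub fin by (intro sum_mono2) auto
  finally have "W * ((1 - \<beta>) * real (card V)) \<le> W * W"
    using deg assms(2) by (simp add: power2_eq_square algebra_simps)
  then show "(1 - \<beta>) * real (card V) \<le> W" using assms(3) by simp
  have "triangles H UNIV \<subseteq> triangles H V \<union> (\<Union>v\<in>\<Union>H - V. triangles_at H v)"
  proof
    fix T assume T: "T \<in> triangles H UNIV"
    show "T \<in> triangles H V \<union> (\<Union>v\<in>\<Union>H - V. triangles_at H v)"
    proof (cases "T \<subseteq> V")
      case True
      then show ?thesis using T by (simp add: triangles_iff)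
    next
      case False
      then obtain v where "v \<in> T" "v \<notin> V" by blast
      then have "v \<in> \<Union>H - V" "T \<in> triangles_at H v"
        using T triangle_subset_Union[OF T] unfolding triangles_at_def by blast+
      then show ?thesis by blast
    qed
  qed
  moreover have "finite (triangles H V \<union> (\<Union>v\<in>\<Union>H - V. triangles_at H v))"
    using finite_triangles[OF assms(1)] fin by (auto simp: triangles_at_def)
  ultimately have "card (triangles H UNIV) \<le> card (triangles H V \<union> (\<Union>v\<in>\<Union>H - V. triangles_at H v))"
    by (rule card_mono[rotated])
  also have "\<dots> \<le> card (triangles H V) + card (\<Union>v\<in>\<Union>H - V. triangles_at H v)"
    by (rule card_Un_le)
  also have "card (\<Union>v\<in>\<Union>H - V. triangles_at H v) \<le> (\<Sum>v\<in>\<Union>H - V. card (triangles_at H v))"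
    using fin by (intro card_UN_le) auto
  finally have "real (card (triangles H UNIV)) \<le> real (card (triangles H V) + (\<Sum>v\<in>\<Union>H - V. card (triangles_at H v)))"
    by (simp only: of_nat_le_iff)
  then have "\<beta> * (real (card (triangles H UNIV)) - real (card (triangles H V))) \<le> \<beta> * (\<Sum>v\<in>\<Union>H - V. ?t v)"
    using assms(4) by (intro mult_left_mono) auto
  also have "\<dots> = (\<Sum>v\<in>\<Union>H - V. \<beta> * ?t v)" by (simp add: sum_distrib_left)
  also have "\<dots> \<le> (\<Sum>v\<in>\<Union>H - V. W * ?d v / 2 - ?t v)"
  proof (rule sum_mono)
    fix v assume "v \<in> \<Union>H - V"
    then have "?d v \<le> (1 - \<beta>) * W" by (auto simp: V_def)
    then have "?d v ^ 2 \<le> (1 - \<beta>) * W * ?d v" by (simp add: power2_eq_square mult_right_mono)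
    then have a: "2 * ?t v \<le> (1 - \<beta>) * W * ?d v"
      using triangles_at_le_degree(2)[OF assms(1-3), of v] by simp
    have "\<beta> * ?t v \<le> \<beta> * (W * ?d v / 2)"
      using triangles_at_le_degree(1)[OF assms(1-3), of v] assms(4) by (intro mult_left_mono) auto
    then show "\<beta> * ?t v \<le> W * ?d v / 2 - ?t v" using a by (simp add: algebra_simps)
  qed
  also have "\<dots> \<le> (\<Sum>v\<in>\<Union>H. W * ?d v / 2 - ?t v)"
    using triangles_at_le_degree(1)[OF assms(1-3)] fin by (intro sum_mono2) auto
  also have "\<dots> = W / 2 * (\<Sum>v\<in>\<Union>H. ?d v) - (\<Sum>v\<in>\<Union>H. ?t v)"
    by (simp add: sum_subtractf sum_distrib_left)
  also have "\<dots> = W * real (card H) - 3 * real (card (triangles H UNIV))" by (simp add: deg tri)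
  also have "W * real (card H) \<le> W * (W^2 / 2)" using assms by (intro mult_left_mono) auto
  finally show "\<beta> * (real (card (triangles H UNIV)) - real (card (triangles H V)))
       \<le> W ^ 3 / 2 - 3 * real (card (triangles H UNIV))" by (simp add: power_numeral_reduce)
qed

section \<open>Cores of the linked triangles\<close>

text \<open>As long as some edge lies in fewer than \<open>h\<close> triangles, it is deleted; each deletion
destroys fewer than \<open>h\<close> triangles.\<close>

lemma prune_light_edges:
  assumes "graph H" "0 \<le> h"
  shows "\<exists>H'\<subseteq>H. real (card (triangles H UNIV)) \<le> real (card (triangles H' UNIV)) + h * real (card H) \<and>
    (\<forall>e\<in>H'. h \<le> real (card {T \<in> triangles H' UNIV. e \<subseteq> T}))"
  using assms(1)
proof (induction "card H" arbitrary: H rule: less_induct)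
  case less
  show ?case
  proof (cases "\<forall>e\<in>H. h \<le> real (card {T \<in> triangles H UNIV. e \<subseteq> T})")
    case True
    then show ?thesis using assms(2) by (intro exI[of _ H]) auto
  next
    case False
    then have "\<exists>e\<in>H. real (card {T \<in> triangles H UNIV. e \<subseteq> T}) < h"
      unfolding Ball_def Bex_def by (simp add: not_le)
    then obtain e where e: "e \<in> H" "real (card {T \<in> triangles H UNIV. e \<subseteq> T}) < h" by blast
    have fin: "finite H" using less.prems by (rule graph_finite)
    have c: "card H = Suc (card (H - {e}))" by (rule card.remove[OF fin e(1)])
    obtain H' where H': "H' \<subseteq> H - {e}"
      "real (card (triangles (H - {e}) UNIV)) \<le> real (card (triangles H' UNIV)) + h * real (card (H - {e}))"
      "\<forall>e\<in>H'. h \<le> real (card {T \<in> triangles H' UNIV. e \<subseteq> T})"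
      using less.hyps[of "H - {e}"] less.prems c graph_subset[OF less.prems, of "H - {e}"] by auto
    have "triangles H UNIV \<subseteq> triangles (H - {e}) UNIV \<union> {T \<in> triangles H UNIV. e \<subseteq> T}"
    proof
      fix T assume T: "T \<in> triangles H UNIV"
      show "T \<in> triangles (H - {e}) UNIV \<union> {T \<in> triangles H UNIV. e \<subseteq> T}"
      proof (cases "e \<subseteq> T")
        case False
        then have "e \<notin> pairs T" by (simp add: pairs_iff)
        then have "pairs T \<subseteq> H - {e}" using T unfolding triangles_iff by blast
        then show ?thesis using T by (simp add: triangles_iff)
      qed (use T in simp)
    qed
    then have "card (triangles H UNIV) \<le> card (triangles (H - {e}) UNIV \<union> {T \<in> triangles H UNIV. e \<subseteq> T})"
      using finite_triangles[OF less.prems, of UNIV] finite_triangles[OF graph_subset[OF less.prems], of "H - {e}" UNIV]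
      by (intro card_mono) auto
    also have "\<dots> \<le> card (triangles (H - {e}) UNIV) + card {T \<in> triangles H UNIV. e \<subseteq> T}"
      by (rule card_Un_le)
    finally have "real (card (triangles H UNIV)) \<le> real (card (triangles (H - {e}) UNIV)) + h"
      using e(2) by linarith
    then have "real (card (triangles H UNIV)) \<le> real (card (triangles H' UNIV)) + h * real (card H)"
      using H'(2) unfolding c by (simp add: algebra_simps)
    then show ?thesis using H' by (intro exI[of _ H']) auto
  qed
qed

text \<open>A vertex of an edge that lies in \<open>h\<close> triangles has degree at least \<open>h\<close>.\<close>

lemma few_vertices_if_edges_heavy:
  assumes "graph H" "\<forall>e\<in>H. h \<le> real (card {T \<in> triangles H UNIV. e \<subseteq> T})"
  shows "h * real (card (\<Union>H)) \<le> 2 * real (card H)"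
proof -
  have "h \<le> real (card (star H v))" if "v \<in> \<Union>H" for v
  proof -
    obtain e where e: "e \<in> H" "v \<in> e" using \<open>v \<in> \<Union>H\<close> by auto
    then have "card e = 2" using assms(1) by (auto simp: graph_def)
    then obtain u where u: "e = {v, u}" "u \<noteq> v" using e(2) by (auto simp: card_2_iff)
    have "card {T \<in> triangles H UNIV. e \<subseteq> T} \<le> card (star H v)"
    proof (rule card_inj_on_le)
      show "inj_on (\<lambda>T. T - {u}) {T \<in> triangles H UNIV. e \<subseteq> T}"
        by (rule inj_on_subset[OF inj_on_delete]) (auto simp: u)
      show "finite (star H v)" using graph_finite[OF assms(1)] by (simp add: star_def)
      show "(\<lambda>T. T - {u}) ` {T \<in> triangles H UNIV. e \<subseteq> T} \<subseteq> star H v"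
      proof safe
        fix T assume T: "T \<in> triangles H UNIV" "e \<subseteq> T"
        then have "card T = 3" "pairs T \<subseteq> H" by (auto simp: triangles_iff)
        moreover have "card (T - {u}) = card T - 1" using T(2) u by (intro card_Diff_singleton) auto
        ultimately show "T - {u} \<in> star H v" using T(2) u by (auto simp: star_def pairs_iff)
      qed
    qed
    then show ?thesis using assms(2) e(1) by force
  qed
  then have "real (card (\<Union>H)) * h \<le> (\<Sum>v\<in>\<Union>H. real (card (star H v)))"
    by (intro sum_bounded_below)
  then show ?thesis using arg_cong[OF sum_degrees[OF assms(1)], of real] by (simp add: mult.commute)
qed

text \<open>The excess \<open>card S - card (\<Union>S)\<close> grows by at least one when a triangle is added that meets \<open>S\<close> in
at least one vertex: sharing one vertex brings two vertices and three edges, sharing two brings one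
vertex and at least two edges, sharing three brings at least one edge.\<close>

lemma excess_add_triangle:
  assumes "graph S" "card T = 3" "T \<inter> \<Union>S \<noteq> {}" "\<not> pairs T \<subseteq> S"
  shows "card (\<Union>(S \<union> pairs T)) + card S + 1 \<le> card (\<Union>S) + card (S \<union> pairs T)"
proof -
  have finT: "finite T" using assms(2) by (simp add: card_ge_0_finite)
  have finS: "finite S" "finite (\<Union>S)" using assms(1) graph_finite graph_finite_vertices by auto
  define A where "A = T \<inter> \<Union>S"
  have A: "finite A" "A \<subseteq> T" using finT by (auto simp: A_def)
  have "card A > 0" using A assms(3) by (simp add: card_gt_0_iff A_def)
  moreover have "card A \<le> 3" using card_mono[OF finT A(2)] assms(2) by simp
  ultimately have cA: "card A \<in> {1,2,3}" by auto
  have "\<Union>(S \<union> pairs T) = \<Union>S \<union> (T - A)" using Union_pairs[OF assms(2)] by (auto simp: A_def)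
  moreover have "card (\<Union>S \<union> (T - A)) = card (\<Union>S) + card (T - A)"
    using finT finS by (intro card_Un_disjoint) (auto simp: A_def)
  moreover have "card (T - A) = 3 - card A" using A assms(2) by (simp add: card_Diff_subset)
  ultimately have v: "card (\<Union>(S \<union> pairs T)) = card (\<Union>S) + (3 - card A)" by simp
  have "card (S \<union> (pairs T - S)) = card S + card (pairs T - S)"
    using finT finS by (intro card_Un_disjoint) auto
  then have e: "card (S \<union> pairs T) = card S + card (pairs T - S)" by simp
  have "pairs T - pairs A \<subseteq> pairs T - S" by (auto simp: A_def pairs_iff)
  then have "card (pairs T - pairs A) \<le> card (pairs T - S)" using finT by (intro card_mono) auto
  moreover have "card (pairs T - pairs A) = 3 - (card A choose 2)"
    using A finT assms(2) by (subst card_Diff_subset) (auto simp: card_pairs_3 card_pairs intro: pairs_mono[THEN subsetD])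
  moreover have "pairs T - S \<noteq> {}" using assms(4) by blast
  then have "card (pairs T - S) > 0" using finT by (simp add: card_gt_0_iff)
  ultimately show ?thesis using v e cA by (auto simp: numeral_eq_Suc)
qed

lemma graph_add_triangle: "graph S \<Longrightarrow> card T = 3 \<Longrightarrow> graph (S \<union> pairs T)"
  using card_ge_0_finite[of T] by (auto simp: graph_def pairs_iff)

lemma card_add_triangle_le: "card T = 3 \<Longrightarrow> card (S \<union> pairs T) \<le> card S + 3"
  using card_Un_le[of S "pairs T"] by (simp add: card_pairs_3)

text \<open>The triangles outside this set are vertex-disjoint from all others and can be counted as such; the
ones inside are expensive because of \<open>linked_triangles_excess\<close>.\<close>

definition linked_triangles :: "nat set set \<Rightarrow> nat set set" where
  "linked_triangles E = {T \<in> triangles E UNIV. \<exists>T'\<in>triangles E UNIV. T' \<noteq> T \<and> T \<inter> T' \<noteq> {}}"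

text \<open>Each surplus of edges over vertices costs a factor \<open>1 / n\<close> in a union bound. The cap \<open>6 * x\<close> on the
edges keeps the number of candidates for \<open>S\<close> small.\<close>

definition has_excess :: "nat \<Rightarrow> nat set set \<Rightarrow> bool" where
  "has_excess x E \<longleftrightarrow> (\<exists>S\<subseteq>E. card S \<le> 6 * x \<and> card (\<Union>S) + x \<le> card S)"

text \<open>As long as not all edges of linked triangles are used, one of them lies in a triangle by which
\<open>S\<close> can be enlarged. If that triangle \<open>T\<close> and its partner \<open>T'\<close> both avoid \<open>S\<close>, then both are added at
once: \<open>T\<close> alone leaves the excess unchanged, and \<open>T'\<close> raises it. This is the step that
adds up to six edges.\<close>

lemma linked_triangles_extend:
  assumes "graph E" "6 * j < card (\<Union>(pairs ` linked_triangles E))"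
    and S: "S \<subseteq> E" "card S \<le> 6 * j" "card (\<Union>S) + j \<le> card S"
  shows "has_excess (Suc j) E"
proof -
  let ?R = "\<Union>(pairs ` linked_triangles E)"
  have gS: "graph S" using graph_subset[OF assms(1) S(1)] .
  have "\<not> ?R \<subseteq> S" using card_mono[OF graph_finite[OF gS], of ?R] assms(2) S(2) by auto
  then obtain T where T: "T \<in> linked_triangles E" "\<not> pairs T \<subseteq> S" by auto
  have step: ?thesis if A: "A \<in> triangles E UNIV" "A \<inter> \<Union>S \<noteq> {}" "\<not> pairs A \<subseteq> S" for A
  proof -
    have A3: "card A = 3" "pairs A \<subseteq> E" using A(1) by (auto simp: triangles_iff)
    have "card (\<Union>(S \<union> pairs A)) + Suc j \<le> card (S \<union> pairs A)"
      using excess_add_triangle[OF gS A3(1) A(2,3)] S(3) by linarith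
    moreover have "card (S \<union> pairs A) \<le> 6 * Suc j" using card_add_triangle_le[OF A3(1), of S] S(2) by simp
    moreover have "S \<union> pairs A \<subseteq> E" using S(1) A3(2) by simp
    ultimately show ?thesis unfolding has_excess_def by blast
  qed
  obtain T' where T': "T' \<in> triangles E UNIV" "T' \<noteq> T" "T \<inter> T' \<noteq> {}" and TE: "T \<in> triangles E UNIV"
    using T(1) by (auto simp: linked_triangles_def)
  have T3: "card T = 3" "card T' = 3" "pairs T \<subseteq> E" "pairs T' \<subseteq> E"
    using TE T'(1) by (auto simp: triangles_iff)
  consider "T \<inter> \<Union>S \<noteq> {}" | "T \<inter> \<Union>S = {}" "T' \<inter> \<Union>S \<noteq> {}" | "T \<inter> \<Union>S = {}" "T' \<inter> \<Union>S = {}" by blast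
  then show ?thesis
  proof cases
    case 1
    then show ?thesis using step[OF TE] T(2) by blast
  next
    case 2
    have "\<not> pairs T' \<subseteq> S"
    proof
      assume "pairs T' \<subseteq> S"
      then have "T' \<subseteq> \<Union>S" using Union_pairs[OF T3(2)] by blast
      then show False using 2(1) T'(3) by blast
    qed
    then show ?thesis using step[OF T'(1)] 2(2) by blast
  next
    case 3
    define S1 where "S1 = S \<union> pairs T"
    have gS1: "graph S1" unfolding S1_def by (rule graph_add_triangle[OF gS T3(1)])
    have US1: "\<Union>S1 = \<Union>S \<union> T" using Union_pairs[OF T3(1)] by (auto simp: S1_def)
    have "S \<inter> pairs A = {}" if "A \<inter> \<Union>S = {}" for A
    proof -
      have "e = {}" if "e \<in> S" "e \<subseteq> A" for e using that \<open>A \<inter> \<Union>S = {}\<close> by blast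
      then show ?thesis by (fastforce simp: pairs_iff)
    qed
    then have dT: "S \<inter> pairs T = {}" "S \<inter> pairs T' = {}" using 3 by blast+
    have "card S1 = card S + 3" unfolding S1_def
      using dT(1) graph_finite[OF gS] card_ge_0_finite[of T] T3(1)
      by (subst card_Un_disjoint) (auto simp: card_pairs_3)
    moreover have "card (\<Union>S1) \<le> card (\<Union>S) + 3" using card_Un_le[of "\<Union>S" T] T3(1) US1 by simp
    moreover have "\<not> pairs T' \<subseteq> S1"
    proof
      assume "pairs T' \<subseteq> S1"
      then have "pairs T' \<subseteq> pairs T" using dT(2) by (auto simp: S1_def)
      then have "T' \<subseteq> T" using Union_pairs[OF T3(1)] Union_pairs[OF T3(2)] by blast
      then show False using card_subset_eq[of T T'] T3 T'(2) card_ge_0_finite[of T] by auto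
    qed
    moreover have "T' \<inter> \<Union>S1 \<noteq> {}" using T'(3) US1 by auto
    ultimately have "card (\<Union>(S1 \<union> pairs T')) + Suc j \<le> card (S1 \<union> pairs T')"
      using excess_add_triangle[OF gS1 T3(2)] S(3) by fastforce
    moreover have "card (S1 \<union> pairs T') \<le> 6 * Suc j"
      using card_add_triangle_le[OF T3(2), of S1] \<open>card S1 = card S + 3\<close> S(2) by simp
    moreover have "S1 \<union> pairs T' \<subseteq> E" using S(1) T3 by (auto simp: S1_def)
    ultimately show ?thesis unfolding has_excess_def by blast
  qed
qed

lemma linked_triangles_excess:
  assumes "graph E" "6 * j < card (\<Union>(pairs ` linked_triangles E))"
  shows "has_excess (Suc j) E"
  using assms(2)
proof (induction j)
  case 0
  then show ?case using linked_triangles_extend[OF assms(1), of 0 "{}"] by simp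
next
  case (Suc j)
  then obtain S where "S \<subseteq> E" "card S \<le> 6 * Suc j" "card (\<Union>S) + Suc j \<le> card S"
    by (auto simp: has_excess_def)
  then show ?case by (rule linked_triangles_extend[OF assms(1) Suc.prems])
qed

lemma isolated_triangles_disjoint: "disjoint (triangles E UNIV - linked_triangles E)"
  by (rule disjointI) (auto simp: linked_triangles_def)

text \<open>The isolated triangles form the disjoint family, and the core arises by pruning the union of the
linked triangles. Disjointness of the two edge sets makes their probabilities multiply.\<close>

lemma core_and_disjoint_triangles:
  assumes "graph E" "0 \<le> h" "card (\<Union>(pairs ` linked_triangles E)) \<le> M"
  obtains H F where "H \<subseteq> E" "card H \<le> M" "h * real (card (\<Union>H)) \<le> 2 * real (card H)"
    "F \<subseteq> triangles E UNIV" "disjoint F" "\<forall>T\<in>F. pairs T \<inter> H = {}"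
    "real (card (triangles E UNIV)) \<le> real (card F) + real (card (triangles H UNIV)) + h * real M"
proof -
  define R where "R = \<Union>(pairs ` linked_triangles E)"
  define F where "F = triangles E UNIV - linked_triangles E"
  have RE: "R \<subseteq> E" by (auto simp: R_def linked_triangles_def triangles_iff)
  have gR: "graph R" using graph_subset[OF assms(1) RE] .
  obtain H where H: "H \<subseteq> R"
    "real (card (triangles R UNIV)) \<le> real (card (triangles H UNIV)) + h * real (card R)"
    "\<forall>e\<in>H. h \<le> real (card {T \<in> triangles H UNIV. e \<subseteq> T})"
    using prune_light_edges[OF gR assms(2)] by auto
  have finE: "finite (triangles E UNIV)" using finite_triangles[OF assms(1)] .
  have sub: "linked_triangles E \<subseteq> triangles E UNIV" by (auto simp: linked_triangles_def)
  have "linked_triangles E \<subseteq> triangles R UNIV"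
  proof
    fix T assume T: "T \<in> linked_triangles E"
    then have "T \<in> triangles E UNIV" using sub by blast
    then show "T \<in> triangles R UNIV" using T by (auto simp: R_def triangles_iff)
  qed
  then have "card (linked_triangles E) \<le> card (triangles R UNIV)"
    by (intro card_mono finite_triangles gR)
  moreover have "card (triangles E UNIV) = card F + card (linked_triangles E)"
    unfolding F_def using finE sub card_mono[OF finE sub] by (simp add: card_Diff_subset finite_subset)
  moreover have "h * real (card R) \<le> h * real M" using assms(2,3) by (intro mult_left_mono) (auto simp: R_def)
  ultimately have "real (card (triangles E UNIV)) \<le> real (card F) + real (card (triangles H UNIV)) + h * real M"
    using H(2) by linarith
  moreover have "pairs T \<inter> H = {}" if T: "T \<in> F" for T
  proof -
    have "pairs T \<inter> pairs T' = {}" if T': "T' \<in> linked_triangles E" for T'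
    proof -
      have "T \<noteq> T'" "T' \<in> triangles E UNIV" using T T' by (auto simp: F_def linked_triangles_def)
      then have "T \<inter> T' = {}" using T by (auto simp: F_def linked_triangles_def)
      then have "e \<notin> pairs T'" if "e \<in> pairs T" for e
        using that subset_empty[of e] Int_greatest[of e T T'] by (auto simp: pairs_iff)
      then show ?thesis by blast
    qed
    then show ?thesis using H(1) by (auto simp: R_def)
  qed
  moreover have "card H \<le> M" using card_mono[OF graph_finite[OF gR] H(1)] assms(3) by (simp add: R_def)
  ultimately show ?thesis
    using few_vertices_if_edges_heavy[OF graph_subset[OF gR H(1)] H(3)] RE H(1) isolated_triangles_disjoint[of E]
    by (intro that[of H F]) (auto simp: F_def)
qed

section \<open>Union bounds in the random graph\<close>

lemma set_pmf_gnp: "E \<in> set_pmf (gnp n p) \<Longrightarrow> E \<subseteq> pairs {..<n}"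
  by (auto simp: gnp_def potential_edges_eq_pairs)

lemma graph_of_gnp: "E \<subseteq> pairs {..<n} \<Longrightarrow> graph E"
  using finite_subset[of E "pairs {..<n}"] by (auto simp: graph_def pairs_def)

lemma triangles_in_range:
  assumes "E \<subseteq> pairs {..<n}" shows "triangles E {..<n} = triangles E UNIV"
proof -
  have "T \<subseteq> {..<n}" if "T \<in> triangles E UNIV" for T
    using triangle_subset_Union[OF that] assms unfolding pairs_def by blast
  then show ?thesis by (auto simp: triangles_iff)
qed

text \<open>The only place where the distribution of the random graph is used.\<close>

lemma prob_contains:
  assumes "0 \<le> p" "p \<le> 1" "S \<subseteq> pairs {..<n}"
  shows "measure_pmf.prob (gnp n p) {E. S \<subseteq> E} = p ^ card S"
proof -
  have fin: "finite (pairs {..<n})" by simp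
  define B where "B e = (if e \<in> S then {True} else UNIV)" for e :: "nat set"
  have eq: "(\<lambda>x. {e \<in> potential_edges n. x e}) -` {E. S \<subseteq> E} = Pi (pairs {..<n}) B"
    using assms(3) by (auto simp: potential_edges_eq_pairs B_def split: if_splits)
  have "measure_pmf.prob (gnp n p) {E. S \<subseteq> E} =
      measure_pmf.prob (Pi_pmf (pairs {..<n}) False (\<lambda>_. bernoulli_pmf p)) (Pi (pairs {..<n}) B)"
    unfolding gnp_def measure_map_pmf eq by (simp add: potential_edges_eq_pairs)
  also have "\<dots> = (\<Prod>e\<in>pairs {..<n}. measure_pmf.prob (bernoulli_pmf p) (B e))"
    by (rule measure_Pi_pmf_Pi[OF fin])
  also have "\<dots> = (\<Prod>e\<in>pairs {..<n}. if e \<in> S then p else 1)"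
    using assms by (intro prod.cong) (auto simp: B_def measure_pmf_single)
  also have "\<dots> = p ^ card S"
    using assms(3) fin by (simp add: prod.If_cases Int_absorb1)
  finally show ?thesis .
qed

lemma prob_mono_on_graphs:
  assumes "\<And>E. E \<subseteq> pairs {..<n} \<Longrightarrow> P E \<Longrightarrow> Q E"
  shows "measure_pmf.prob (gnp n p) {E. P E} \<le> measure_pmf.prob (gnp n p) {E. Q E}"
  by (rule measure_pmf.finite_measure_mono_AE)
     (use assms set_pmf_gnp[of _ n p] in \<open>auto simp: AE_measure_pmf_iff\<close>)

lemma prob_contains_some:
  assumes "0 \<le> p" "p \<le> 1" "finite I" "\<And>i. i \<in> I \<Longrightarrow> S i \<subseteq> pairs {..<n}"
  shows "measure_pmf.prob (gnp n p) {E. \<exists>i\<in>I. S i \<subseteq> E} \<le> (\<Sum>i\<in>I. p ^ card (S i))"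
proof -
  have "{E. \<exists>i\<in>I. S i \<subseteq> E} = (\<Union>i\<in>I. {E. S i \<subseteq> E})" by auto
  then have "measure_pmf.prob (gnp n p) {E. \<exists>i\<in>I. S i \<subseteq> E}
      \<le> (\<Sum>i\<in>I. measure_pmf.prob (gnp n p) {E. S i \<subseteq> E})"
    using measure_pmf.finite_measure_subadditive_finite[OF assms(3), of "\<lambda>i. {E. S i \<subseteq> E}"] by simp
  also have "\<dots> = (\<Sum>i\<in>I. p ^ card (S i))" using prob_contains assms by (intro sum.cong) auto
  finally show ?thesis .
qed

text \<open>Each step adds one vertex or, encoded by the dummy vertex \<open>n\<close>, none.\<close>

lemma card_small_subsets: "card {U. U \<subseteq> {..<n} \<and> card U \<le> r} \<le> (n + 1) ^ r"
proof (induction r)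
  case 0
  have "{U. U \<subseteq> {..<n} \<and> card U \<le> 0} = {{}}"
    using finite_subset[of _ "{..<n}"] by auto
  then show ?case by simp
next
  case (Suc r)
  define A where "A = {U. U \<subseteq> {..<n} \<and> card U \<le> r}"
  have finA: "finite A" unfolding A_def by (rule finite_subset[of _ "Pow {..<n}"]) auto
  have "{U. U \<subseteq> {..<n} \<and> card U \<le> Suc r} \<subseteq> (\<lambda>(x,U). insert x U - {n}) ` ({..n} \<times> A)"
  proof
    fix U assume "U \<in> {U. U \<subseteq> {..<n} \<and> card U \<le> Suc r}"
    then have U: "U \<subseteq> {..<n}" "card U \<le> Suc r" by auto
    show "U \<in> (\<lambda>(x,U). insert x U - {n}) ` ({..n} \<times> A)"
    proof (cases "U = {}")
      case True
      then show ?thesis by (intro image_eqI[of _ _ "(n, {})"]) (auto simp: A_def)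
    next
      case False
      then obtain x where x: "x \<in> U" by blast
      have "n \<notin> U" using U(1) by auto
      moreover have "card (U - {x}) \<le> r" using U(2) x by (simp add: card_Diff_singleton)
      moreover have "x \<le> n" using U(1) x by auto
      ultimately show ?thesis using U(1) x by (intro image_eqI[of _ _ "(x, U - {x})"]) (auto simp: A_def)
    qed
  qed
  then have "card {U. U \<subseteq> {..<n} \<and> card U \<le> Suc r} \<le> card ({..n} \<times> A)"
    using finA by (intro surj_card_le) auto
  also have "\<dots> = (n + 1) * card A" by (simp add: card_cartesian_product)
  also have "\<dots> \<le> (n + 1) * (n + 1) ^ r" using Suc unfolding A_def by (rule mult_left_mono) simp
  finally show ?case by simp
qed

lemma choose_two_le_square: "r choose 2 \<le> r ^ 2"
  by (cases "2 \<le> r") (auto simp: binomial_le_pow binomial_eq_0)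

lemma card_graphs_few_vertices:
  assumes "\<And>A. finite A \<Longrightarrow> card A \<le> r ^ 2 \<Longrightarrow> card {H. H \<subseteq> A \<and> P H} \<le> c"
  shows "card {H. H \<subseteq> pairs {..<n} \<and> card (\<Union>H) \<le> r \<and> P H} \<le> (n + 1) ^ r * c"
proof -
  define A where "A = {U. U \<subseteq> {..<n} \<and> card U \<le> r}"
  have finA: "finite A" unfolding A_def by (rule finite_subset[of _ "Pow {..<n}"]) auto
  have finU: "finite U" if "U \<in> A" for U using that finite_subset by (auto simp: A_def)
  have "{H. H \<subseteq> pairs {..<n} \<and> card (\<Union>H) \<le> r \<and> P H} \<subseteq> (\<Union>U\<in>A. {H. H \<subseteq> pairs U \<and> P H})"
  proof
    fix H assume "H \<in> {H. H \<subseteq> pairs {..<n} \<and> card (\<Union>H) \<le> r \<and> P H}"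
    then have H: "H \<subseteq> pairs {..<n}" "card (\<Union>H) \<le> r" "P H" by auto
    then have "\<Union>H \<in> A" by (auto simp: A_def pairs_iff subset_iff)
    moreover have "H \<subseteq> pairs (\<Union>H)" using graph_subset_pairs graph_of_gnp H(1) by blast
    ultimately show "H \<in> (\<Union>U\<in>A. {H. H \<subseteq> pairs U \<and> P H})" using H(3) by blast
  qed
  moreover have "finite {H. H \<subseteq> pairs U \<and> P H}" if "U \<in> A" for U
    by (rule finite_subset[of _ "Pow (pairs U)"]) (use finU that in auto)
  ultimately have "card {H. H \<subseteq> pairs {..<n} \<and> card (\<Union>H) \<le> r \<and> P H} \<le> card (\<Union>U\<in>A. {H. H \<subseteq> pairs U \<and> P H})"
    using finA by (intro card_mono) auto
  also have "\<dots> \<le> (\<Sum>U\<in>A. card {H. H \<subseteq> pairs U \<and> P H})" by (rule card_UN_le[OF finA])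
  also have "\<dots> \<le> (\<Sum>U\<in>A. c)"
  proof (rule sum_mono)
    fix U assume U: "U \<in> A"
    have "card (pairs U) \<le> card U ^ 2"
      using finU[OF U] choose_two_le_square by (simp add: card_pairs)
    also have "\<dots> \<le> r ^ 2" using U by (intro power_mono) (auto simp: A_def)
    finally show "card {H. H \<subseteq> pairs U \<and> P H} \<le> c"
      using finU[OF U] by (intro assms) auto
  qed
  also have "\<dots> \<le> (n + 1) ^ r * c" using card_small_subsets[of n r] by (simp add: A_def)
  finally show ?thesis .
qed

lemma binomial_le_power: "n choose s \<le> n ^ s"
proof -
  have "(n choose s) * 1 \<le> (n choose s) * fact s" by (intro mult_left_mono) auto
  then show ?thesis using binomial_fact_pow[of n s] by linarith
qed

text \<open>A subgraph with \<open>e\<close> edges and at most \<open>e - X\<close> vertices is chosen by its vertices, in about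
\<open>n ^ (e - X)\<close> ways, and by its edges, in at most \<open>(25 * X\<^sup>2) ^ e\<close> ways. Against the probability
\<open>(d / n) ^ e\<close> this leaves a factor \<open>n ^ - X\<close> times a power of \<open>X\<close> with exponent proportional to
\<open>X\<close>.\<close>

lemma prob_excess_le:
  assumes "0 < d" "d \<le> real n" "1 \<le> X"
  shows "measure_pmf.prob (gnp n (d / real n)) {E. has_excess X E}
    \<le> ((50 * real X ^ 2 * max 1 d) ^ 7 / real n) ^ X"
proof -
  define p where "p = d / real n"
  define B where "B = 50 * real X ^ 2 * max 1 d"
  have n: "0 < n" using assms by (cases n) auto
  have p: "0 \<le> p" "p \<le> 1" using assms n by (auto simp: p_def)
  define G where "G e = {S. S \<subseteq> pairs {..<n} \<and> card (\<Union>S) \<le> e - X \<and> card S = e}" for e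
  have finG: "finite (G e)" for e
    unfolding G_def by (rule finite_subset[of _ "Pow (pairs {..<n})"]) auto
  have X1: "1 \<le> real X ^ 2" using assms(3) by simp
  then have B50: "50 \<le> B" unfolding B_def using mult_mono[of 1 "real X ^ 2" 1 "max 1 d"] by simp
  have cardG: "real (card (G e)) * p ^ e \<le> B ^ (6 * X) / real n ^ X" if e: "e \<in> {X..6*X}" for e
  proof -
    have "card (G e) \<le> (n + 1) ^ (e - X) * ((e - X) ^ 2) ^ e"
      unfolding G_def
    proof (rule card_graphs_few_vertices)
      fix A :: "nat set set" assume A: "finite A" "card A \<le> (e - X) ^ 2"
      have "card {H. H \<subseteq> A \<and> card H = e} \<le> card A ^ e"
        using A(1) binomial_le_power by (simp add: n_subsets)
      also have "\<dots> \<le> ((e - X) ^ 2) ^ e" using A(2) by (rule power_mono) simp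
      finally show "card {H. H \<subseteq> A \<and> card H = e} \<le> ((e - X) ^ 2) ^ e" .
    qed
    also have "\<dots> \<le> (2 * n) ^ (e - X) * ((5 * X) ^ 2) ^ e"
      using e n by (intro mult_mono power_mono) auto
    finally have "real (card (G e)) \<le> real ((2 * n) ^ (e - X) * ((5 * X) ^ 2) ^ e)" by (simp only: of_nat_le_iff)
    then have "real (card (G e)) * p ^ e \<le> real ((2 * n) ^ (e - X) * ((5 * X) ^ 2) ^ e) * p ^ e"
      using p(1) by (intro mult_right_mono) auto
    also have "\<dots> = 2 ^ (e - X) * (real n ^ (e - X) / real n ^ e) * (25 * real X ^ 2 * d) ^ e"
      by (simp add: p_def power_mult_distrib power_divide)
    also have "real n ^ (e - X) / real n ^ e = 1 / real n ^ X"
      using e n by (simp add: power_diff)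
    also have "2 ^ (e - X) * (1 / real n ^ X) * (25 * real X ^ 2 * d) ^ e
        \<le> 2 ^ e * (1 / real n ^ X) * (25 * real X ^ 2 * max 1 d) ^ e"
      using assms(1) by (intro mult_mono power_mono power_increasing) auto
    also have "\<dots> = (2 * (25 * real X ^ 2 * max 1 d)) ^ e / real n ^ X"
      unfolding power_mult_distrib[of 2 "25 * real X ^ 2 * max 1 d"] by (simp only: times_divide_eq_right times_divide_eq_left mult_1_right)
    also have "2 * (25 * real X ^ 2 * max 1 d) = B" unfolding B_def by algebra
    also have "B ^ e / real n ^ X \<le> B ^ (6 * X) / real n ^ X"
      using e B50 by (intro divide_right_mono power_increasing) auto
    finally show ?thesis .
  qed
  have "measure_pmf.prob (gnp n p) {E. has_excess X E}
      \<le> measure_pmf.prob (gnp n p) {E. \<exists>S\<in>(\<Union>e\<in>{X..6*X}. G e). S \<subseteq> E}"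
  proof (rule prob_mono_on_graphs, unfold has_excess_def, elim exE conjE)
    fix E S assume "E \<subseteq> pairs {..<n}" "S \<subseteq> E" "card S \<le> 6 * X" "card (\<Union>S) + X \<le> card S"
    then show "\<exists>S\<in>(\<Union>e\<in>{X..6*X}. G e). S \<subseteq> E"
      by (intro bexI[of _ S] UN_I[of "card S"]) (auto simp: G_def)
  qed
  also have "\<dots> \<le> (\<Sum>S\<in>(\<Union>e\<in>{X..6*X}. G e). p ^ card S)"
    using p finG by (intro prob_contains_some) (auto simp: G_def)
  also have "\<dots> = (\<Sum>e\<in>{X..6*X}. \<Sum>S\<in>G e. p ^ card S)"
    using finG by (intro sum.UNION_disjoint) (auto simp: G_def)
  also have "\<dots> = (\<Sum>e\<in>{X..6*X}. real (card (G e)) * p ^ e)"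
    by (intro sum.cong refl) (auto simp: G_def)
  also have "\<dots> \<le> (\<Sum>e\<in>{X..6*X}. B ^ (6 * X) / real n ^ X)" by (intro sum_mono cardG)
  also have "\<dots> \<le> (6 * real X) * (B ^ (6 * X) / real n ^ X)"
    using assms(3) B50 by (simp add: mult_right_mono divide_right_mono)
  also have "\<dots> \<le> B ^ X * (B ^ (6 * X) / real n ^ X)"
  proof (rule mult_right_mono)
    have "real X \<le> real X ^ 2" using assms(3) by (simp add: self_le_power)
    also have "\<dots> \<le> real X ^ 2 * max 1 d" by (simp add: mult_le_cancel_left1)
    finally have "6 * real X \<le> B" unfolding B_def by linarith
    also have "B \<le> B ^ X" using B50 assms(3) by (intro self_le_power) auto
    finally show "6 * real X \<le> B ^ X" .
  qed (use B50 in auto)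
  also have "\<dots> = (B ^ 7 / real n) ^ X"
    by (simp add: power_divide flip: power_mult power_add)
  finally show ?thesis by (simp add: p_def B_def)
qed

lemma disjoint_triples_finite:
  "F \<subseteq> {T. T \<subseteq> {..<n::nat} \<and> card T = 3} \<Longrightarrow> finite F"
  by (rule finite_subset[of F "Pow {..<n}"]) auto

lemma card_edges_disjoint_triples:
  assumes "finite F" "disjoint F" "\<And>T. T \<in> F \<Longrightarrow> card T = 3"
  shows "card (\<Union>(pairs ` F)) = 3 * card F"
proof -
  have "pairs A \<inter> pairs B = {}" if "A \<in> F" "B \<in> F" "A \<noteq> B" for A B
  proof -
    have "A \<inter> B = {}" using assms(2) that by (auto simp: disjoint_def)
    then have "e \<notin> pairs B" if "e \<in> pairs A" for e
      using that subset_empty[of e] Int_greatest[of e A B] by (auto simp: pairs_iff)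
    then show ?thesis by blast
  qed
  moreover have "finite (pairs T)" if "T \<in> F" for T using assms(3)[OF that] by (simp add: card_ge_0_finite)
  ultimately have "card (\<Union>(pairs ` F)) = (\<Sum>T\<in>F. card (pairs T))"
    using assms(1) by (intro card_UN_disjoint) auto
  also have "\<dots> = (\<Sum>T\<in>F. 3)" using assms(3) by (intro sum.cong) (auto simp: card_pairs_3)
  finally show ?thesis by simp
qed

lemma choose_three_le: "real (n choose 3) \<le> real n ^ 3 / 6"
proof -
  have "(n choose 3) * fact 3 \<le> n ^ 3" by (rule binomial_fact_pow)
  then have "real ((n choose 3) * fact 3) \<le> real (n ^ 3)" by (simp only: of_nat_le_iff)
  then show ?thesis by (simp add: fact_numeral)
qed

lemma binomial_le_power_over_fact: "real (n choose s) \<le> real n ^ s / fact s"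
proof -
  have "(n choose s) * fact s \<le> n ^ s" by (rule binomial_fact_pow)
  then have "real ((n choose s) * fact s) \<le> real (n ^ s)" by (simp only: of_nat_le_iff)
  then show ?thesis by (simp add: field_simps)
qed

text \<open>The number \<open>s H\<close> of additional triangles may depend on the core \<open>H\<close>, since a core with fewer triangles
has to be accompanied by more of them.\<close>

definition core_event :: "nat set set set \<Rightarrow> (nat set set \<Rightarrow> nat) \<Rightarrow> nat set set \<Rightarrow> bool" where
  "core_event \<H> s E \<longleftrightarrow> (\<exists>H\<in>\<H>. H \<subseteq> E \<and>
     (\<exists>F\<subseteq>triangles E UNIV. disjoint F \<and> card F = s H \<and> (\<forall>T\<in>F. pairs T \<inter> H = {})))"

lemma prob_core_event_le:
  assumes "0 \<le> p" "p \<le> 1" "\<And>H. H \<in> \<H> \<Longrightarrow> H \<subseteq> pairs {..<n}"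
  shows "measure_pmf.prob (gnp n p) {E. core_event \<H> s E}
    \<le> (\<Sum>H\<in>\<H>. p ^ card H * (((real n * p) ^ 3 / 6) ^ s H / fact (s H)))"
proof -
  define Tr where "Tr = {T. T \<subseteq> {..<n} \<and> card T = 3}"
  define Fs where "Fs H = {F. F \<subseteq> Tr \<and> card F = s H \<and> disjoint F \<and> (\<forall>T\<in>F. pairs T \<inter> H = {})}" for H
  have finTr: "finite Tr" unfolding Tr_def by (rule finite_subset[of _ "Pow {..<n}"]) auto
  have finH: "finite \<H>" by (rule finite_subset[of _ "Pow (pairs {..<n})"]) (use assms in auto)
  have finFs: "finite (Fs H)" for H
    unfolding Fs_def by (rule finite_subset[of _ "Pow Tr"]) (use finTr in auto)
  have sub: "\<Union>(pairs ` F) \<subseteq> pairs {..<n}" if "F \<in> Fs H" for F H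
    using that unfolding Fs_def Tr_def by (intro UN_least pairs_mono) blast
  have "measure_pmf.prob (gnp n p) {E. core_event \<H> s E}
    \<le> measure_pmf.prob (gnp n p) {E. \<exists>HF\<in>Sigma \<H> Fs. fst HF \<union> \<Union>(pairs ` snd HF) \<subseteq> E}"
  proof (rule prob_mono_on_graphs)
    fix E assume E: "E \<subseteq> pairs {..<n}" "core_event \<H> s E"
    then obtain H F where HF: "H \<in> \<H>" "H \<subseteq> E" "F \<subseteq> triangles E UNIV" "disjoint F" "card F = s H"
      "\<forall>T\<in>F. pairs T \<inter> H = {}" by (auto simp: core_event_def)
    have "T \<in> Tr \<and> pairs T \<subseteq> E" if "T \<in> F" for T
    proof -
      have T: "T \<in> triangles E UNIV" using HF(3) that by blast
      have "T \<subseteq> \<Union>E" by (rule triangle_subset_Union[OF T])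
      moreover have "\<Union>E \<subseteq> {..<n}" using E(1) unfolding pairs_def by blast
      ultimately have "T \<subseteq> {..<n}" by (rule subset_trans)
      then show ?thesis using T unfolding Tr_def triangles_iff by blast
    qed
    then have "F \<in> Fs H" "\<Union>(pairs ` F) \<subseteq> E" using HF(4-6) unfolding Fs_def by blast+
    then show "\<exists>HF\<in>Sigma \<H> Fs. fst HF \<union> \<Union>(pairs ` snd HF) \<subseteq> E"
      using HF(1,2) by (intro bexI[of _ "(H, F)"]) auto
  qed
  also have "\<dots> \<le> (\<Sum>HF\<in>Sigma \<H> Fs. p ^ card (fst HF \<union> \<Union>(pairs ` snd HF)))"
  proof (intro prob_contains_some assms(1,2))
    fix HF assume "HF \<in> Sigma \<H> Fs"
    then have "fst HF \<in> \<H>" "snd HF \<in> Fs (fst HF)" by auto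
    then show "fst HF \<union> \<Union>(pairs ` snd HF) \<subseteq> pairs {..<n}"
      by (intro Un_least assms(3) sub)
  qed (use finH finFs in auto)
  also have "\<dots> = (\<Sum>(H,F)\<in>Sigma \<H> Fs. p ^ (card H + 3 * s H))"
  proof (rule sum.cong[OF refl], clarsimp)
    fix H F assume HF: "H \<in> \<H>" "F \<in> Fs H"
    have F3: "card T = 3" if "T \<in> F" for T using HF(2) that by (auto simp: Fs_def Tr_def)
    have finF: "finite F" using HF(2) finTr finite_subset by (auto simp: Fs_def)
    have "finite H" using assms(3)[OF HF(1)] by (rule finite_subset) simp
    moreover have "finite (\<Union>(pairs ` F))" using sub[OF HF(2)] by (rule finite_subset) simp
    moreover have "H \<inter> \<Union>(pairs ` F) = {}" using HF(2) by (auto simp: Fs_def)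
    ultimately have "card (H \<union> \<Union>(pairs ` F)) = card H + card (\<Union>(pairs ` F))"
      by (rule card_Un_disjoint)
    also have "card (\<Union>(pairs ` F)) = 3 * s H"
      using card_edges_disjoint_triples[OF finF _ F3] HF(2) by (auto simp: Fs_def)
    finally show "p ^ card (H \<union> \<Union>(pairs ` F)) = p ^ (card H + 3 * s H)" by simp
  qed
  also have "\<dots> = (\<Sum>H\<in>\<H>. \<Sum>F\<in>Fs H. p ^ (card H + 3 * s H))"
    using finH finFs by (subst sum.Sigma) auto
  also have "\<dots> = (\<Sum>H\<in>\<H>. real (card (Fs H)) * p ^ (card H + 3 * s H))" by simp
  also have "\<dots> \<le> (\<Sum>H\<in>\<H>. p ^ card H * (((real n * p) ^ 3 / 6) ^ s H / fact (s H)))"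
  proof (rule sum_mono)
    fix H assume "H \<in> \<H>"
    have "card (Fs H) \<le> card {F. F \<subseteq> Tr \<and> card F = s H}"
    proof (rule card_mono)
      show "finite {F. F \<subseteq> Tr \<and> card F = s H}"
        by (rule finite_subset[of _ "Pow Tr"]) (use finTr in auto)
    qed (auto simp: Fs_def)
    also have "\<dots> = (n choose 3) choose s H"
      using finTr by (simp add: n_subsets Tr_def)
    finally have "real (card (Fs H)) \<le> real ((n choose 3) choose s H)" by simp
    also have "\<dots> \<le> real (n choose 3) ^ s H / fact (s H)" by (rule binomial_le_power_over_fact)
    also have "\<dots> \<le> (real n ^ 3 / 6) ^ s H / fact (s H)"
      by (intro divide_right_mono power_mono choose_three_le) auto
    finally have "real (card (Fs H)) * p ^ (card H + 3 * s H) \<le> (real n ^ 3 / 6) ^ s H / fact (s H) * p ^ (card H + 3 * s H)"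
      using assms(1) by (intro mult_right_mono) auto
    also have "\<dots> = p ^ card H * (((real n * p) ^ 3 / 6) ^ s H / fact (s H))"
      by (simp add: power_add power_mult power_mult_distrib power_divide)
    finally show "real (card (Fs H)) * p ^ (card H + 3 * s H) \<le> p ^ card H * (((real n * p) ^ 3 / 6) ^ s H / fact (s H))" .
  qed
  finally show ?thesis .
qed

section \<open>Lower bounds for many triangles\<close>

lemma triangles_pairs: "triangles (pairs A) A = {T. T \<subseteq> A \<and> card T = 3}"
  using pairs_mono by (auto simp: triangles_iff)

lemma prob_clique:
  assumes "0 \<le> p" "p \<le> 1" "m \<le> n" "k \<le> m choose 3"
  shows "p ^ (m choose 2) \<le> measure_pmf.prob (gnp n p) {E. k \<le> num_triangles E {..<n}}"
proof -
  have "p ^ (m choose 2) = measure_pmf.prob (gnp n p) {E. pairs {..<m} \<subseteq> E}"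
    using assms pairs_mono[of "{..<m}" "{..<n}"] by (subst prob_contains) (auto simp: card_pairs)
  also have "\<dots> \<le> measure_pmf.prob (gnp n p) {E. k \<le> num_triangles E {..<n}}"
  proof (rule prob_mono_on_graphs)
    fix E assume E: "E \<subseteq> pairs {..<n}" "pairs {..<m} \<subseteq> E"
    have "k \<le> card (triangles (pairs {..<m}) {..<m})" using assms(4) by (simp add: triangles_pairs n_subsets)
    also have "\<dots> \<le> card (triangles E {..<n})"
      using E assms(3) by (intro card_mono finite_triangles triangles_mono graph_of_gnp) auto
    finally show "k \<le> num_triangles E {..<n}" by (simp add: num_triangles_def)
  qed
  finally show ?thesis .
qed

definition disjoint_triples :: "nat \<Rightarrow> nat \<Rightarrow> nat set set set" where
  "disjoint_triples M k = {F. F \<subseteq> {T. T \<subseteq> {..<M} \<and> card T = 3} \<and> disjoint F \<and> card F = k}"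

lemma finite_disjoint_triples: "finite (disjoint_triples M k)"
  unfolding disjoint_triples_def by (rule finite_subset[of _ "Pow (Pow {..<M})"]) auto

lemma card_Union_triples:
  assumes "F \<in> disjoint_triples M k" shows "card (\<Union>F) = 3 * k"
proof -
  have F: "finite F" "disjoint F" "card F = k" "\<And>T. T \<in> F \<Longrightarrow> card T = 3"
    using assms disjoint_triples_finite by (auto simp: disjoint_triples_def)
  have "card (\<Union>F) = (\<Sum>T\<in>F. card T)"
    using F by (intro card_Union_disjoint) (auto simp: disjoint_def pairwise_def disjnt_def card_ge_0_finite)
  then show ?thesis using F by simp
qed

text \<open>Both sides count families of \<open>k + 1\<close> disjoint triples with a distinguished member.\<close>

lemma disjoint_triples_Suc:
  "card (disjoint_triples M k) * ((M - 3 * k) choose 3) \<le> card (disjoint_triples M (Suc k)) * Suc k"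
proof -
  define Ts where "Ts F = {T. T \<subseteq> {..<M} - \<Union>F \<and> card T = 3}" for F :: "nat set set"
  have finTs: "finite (Ts F)" for F unfolding Ts_def by (rule finite_subset[of _ "Pow {..<M}"]) auto
  have "card (Sigma (disjoint_triples M k) Ts) = (\<Sum>F\<in>disjoint_triples M k. card (Ts F))"
    using finite_disjoint_triples finTs by (subst card_SigmaI) auto
  also have "\<dots> = (\<Sum>F\<in>disjoint_triples M k. (M - 3 * k) choose 3)"
  proof (rule sum.cong[OF refl])
    fix F assume F: "F \<in> disjoint_triples M k"
    then have "\<Union>F \<subseteq> {..<M}" by (auto simp: disjoint_triples_def)
    then have "card ({..<M} - \<Union>F) = M - 3 * k"
      using card_Union_triples[OF F] finite_subset[of "\<Union>F" "{..<M}"] by (subst card_Diff_subset) auto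
    then show "card (Ts F) = (M - 3 * k) choose 3" by (simp add: Ts_def n_subsets)
  qed
  finally have 1: "card (Sigma (disjoint_triples M k) Ts) = card (disjoint_triples M k) * ((M - 3 * k) choose 3)" by simp
  have finF: "finite F" if "F \<in> disjoint_triples M j" for F j
    using that disjoint_triples_finite by (auto simp: disjoint_triples_def)
  have "card (Sigma (disjoint_triples M (Suc k)) (\<lambda>F. F)) = (\<Sum>F\<in>disjoint_triples M (Suc k). card F)"
    using finite_disjoint_triples finF by (subst card_SigmaI) auto
  also have "\<dots> = (\<Sum>F\<in>disjoint_triples M (Suc k). Suc k)"
    by (rule sum.cong) (auto simp: disjoint_triples_def)
  finally have 2: "card (Sigma (disjoint_triples M (Suc k)) (\<lambda>F. F)) = card (disjoint_triples M (Suc k)) * Suc k" by simp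
  have new: "T \<notin> F" if "T \<in> Ts F" for T F
  proof
    assume "T \<in> F"
    then have "T = {}" using that by (auto simp: Ts_def)
    then show False using that by (simp add: Ts_def)
  qed
  have "card (Sigma (disjoint_triples M k) Ts) \<le> card (Sigma (disjoint_triples M (Suc k)) (\<lambda>F. F))"
  proof (rule card_inj_on_le)
    show "inj_on (\<lambda>(F,T). (insert T F, T)) (Sigma (disjoint_triples M k) Ts)"
    proof (rule inj_onI, clarsimp)
      fix F F' T assume "T \<in> Ts F" "T \<in> Ts F'" "insert T F = insert T F'"
      then show "F = F'" using new[of T F] new[of T F'] by (simp add: insert_ident)
    qed
    show "(\<lambda>(F,T). (insert T F, T)) ` Sigma (disjoint_triples M k) Ts \<subseteq> Sigma (disjoint_triples M (Suc k)) (\<lambda>F. F)"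
    proof clarsimp
      fix F T assume F: "F \<in> disjoint_triples M k" and T: "T \<in> Ts F"
      have "A \<inter> T = {}" if "A \<in> F" for A using T that by (auto simp: Ts_def)
      moreover have "card (insert T F) = Suc k"
        using new[OF T] finF[OF F] F by (simp add: disjoint_triples_def)
      moreover have "T \<subseteq> {..<M}" "card T = 3" using T by (auto simp: Ts_def)
      moreover have "F \<subseteq> {T. T \<subseteq> {..<M} \<and> card T = 3}" "disjoint F"
        using F unfolding disjoint_triples_def by blast+
      moreover have "disjoint (insert T F)"
        using calculation(1,6) by (simp add: pairwise_insert disjnt_def Int_commute)
      ultimately show "insert T F \<in> disjoint_triples M (Suc k)"
        by (simp add: disjoint_triples_def)
    qed
    show "finite (Sigma (disjoint_triples M (Suc k)) (\<lambda>F. F))"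
      using finite_disjoint_triples finF by (intro finite_SigmaI) auto
  qed
  then show ?thesis using 1 2 by simp
qed

lemma card_disjoint_triples_ge:
  assumes "j \<le> k"
  shows "((M - 3 * k) choose 3) ^ j \<le> card (disjoint_triples M j) * fact j"
  using assms
proof (induction j)
  case 0
  have "disjoint_triples M 0 = {{}}"
    using disjoint_triples_finite[of _ M] by (auto simp: disjoint_triples_def card_eq_0_iff)
  then show ?case by simp
next
  case (Suc j)
  have "((M - 3 * k) choose 3) ^ Suc j \<le> ((M - 3 * k) choose 3) * (card (disjoint_triples M j) * fact j)"
    using Suc by simp
  also have "\<dots> \<le> ((M - 3 * j) choose 3) * (card (disjoint_triples M j) * fact j)"
    using Suc.prems by (intro mult_right_mono binomial_right_mono) auto
  also have "\<dots> \<le> (card (disjoint_triples M (Suc j)) * Suc j) * fact j"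
    using mult_right_mono[OF disjoint_triples_Suc[of M j], of "fact j"] by (simp add: ac_simps)
  finally show ?case by (simp add: algebra_simps)
qed

text \<open>Two edges of a triangle share a vertex, so if they belong to members of a disjoint family they
belong to the same member, which is then the triangle itself.\<close>

lemma shared_edges_le_1:
  assumes "disjoint F" "card T = 3" "T \<notin> F" "\<And>A. A \<in> F \<Longrightarrow> card A = 3"
  shows "card (pairs T \<inter> \<Union>(pairs ` F)) \<le> 1"
proof -
  have "e = e'" if e: "e \<in> pairs T" "e \<in> pairs A" "A \<in> F" and e': "e' \<in> pairs T" "e' \<in> pairs A'" "A' \<in> F" for e e' A A'
  proof (rule ccontr)
    assume "e \<noteq> e'"
    have fin: "finite T" using assms(2) by (simp add: card_ge_0_finite)
    have ee: "e \<subseteq> T" "card e = 2" "e' \<subseteq> T" "card e' = 2" "e \<subseteq> A" "e' \<subseteq> A'"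
      using e(1,2) e'(1,2) by (auto simp: pairs_iff)
    have fine: "finite e" "finite e'" using finite_subset[OF ee(1) fin] finite_subset[OF ee(3) fin] by auto
    have sub: "e \<union> e' \<subseteq> T" using ee by auto
    have le: "card (e \<union> e') \<le> 3" using card_mono[OF fin sub] assms(2) by simp
    have un: "card (e \<union> e') + card (e \<inter> e') = 4" using card_Un_Int[OF fine] ee by simp
    have "card (e \<inter> e') \<noteq> 2"
      using card_subset_eq[of e "e \<inter> e'"] card_subset_eq[of e' "e \<inter> e'"] fine ee \<open>e \<noteq> e'\<close> by auto
    moreover have "card (e \<inter> e') \<le> 2" using card_mono[of e "e \<inter> e'"] fine ee by simp
    ultimately have c: "card (e \<inter> e') = 1" "card (e \<union> e') = 3" using le un by linarith+
    then have "e \<inter> e' \<noteq> {}" by auto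
    then have "A \<inter> A' \<noteq> {}" using ee by blast
    then have "A = A'" using assms(1) e(3) e'(3) by (auto simp: disjoint_def)
    then have "e \<union> e' \<subseteq> A" using ee by auto
    moreover have "e \<union> e' = T" using card_subset_eq[OF fin sub] c assms(2) by simp
    moreover have "finite A" "card A = 3" using assms(4)[OF e(3)] by (auto simp: card_ge_0_finite)
    ultimately have "A = T" using card_subset_eq[of A T] assms(2) by simp
    then show False using assms(3) e(3) by simp
  qed
  then have "\<forall>e\<in>pairs T \<inter> \<Union>(pairs ` F). \<forall>e'\<in>pairs T \<inter> \<Union>(pairs ` F). e = e'"
    by (intro ballI) (elim IntE UN_E)
  moreover have "finite (pairs T \<inter> \<Union>(pairs ` F))" using assms(2) by (simp add: card_ge_0_finite)
  ultimately show ?thesis using card_le_Suc0_iff_eq by (metis One_nat_def)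
qed

lemma card_triples_containing_edge:
  "finite Q \<Longrightarrow> card {T. T \<subseteq> {..<M} \<and> card T = 3 \<and> pairs T \<inter> Q \<noteq> {}} \<le> card Q * M"
proof -
  assume Q: "finite Q"
  have "{T. T \<subseteq> {..<M} \<and> card T = 3 \<and> pairs T \<inter> Q \<noteq> {}} \<subseteq> (\<lambda>(e,x). insert x e) ` (Q \<times> {..<M})"
  proof clarify
    fix T assume T: "T \<subseteq> {..<M}" "card T = 3" "pairs T \<inter> Q \<noteq> {}"
    then obtain e where e: "e \<in> Q" "e \<subseteq> T" "card e = 2" by (auto simp: pairs_iff)
    have fin: "finite T" using T(2) by (simp add: card_ge_0_finite)
    have "card (T - e) = 1" using e T(2) fin finite_subset[OF e(2)] by (simp add: card_Diff_subset)
    then obtain x where "T - e = {x}" by (auto simp: card_1_singleton_iff)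
    then have "T = insert x e" "x \<in> {..<M}" using e(2) T(1) by blast+
    then show "T \<in> (\<lambda>(e,x). insert x e) ` (Q \<times> {..<M})" using e(1) by (intro image_eqI[of _ _ "(e,x)"]) auto
  qed
  then have "card {T. T \<subseteq> {..<M} \<and> card T = 3 \<and> pairs T \<inter> Q \<noteq> {}} \<le> card (Q \<times> {..<M})"
    using Q by (intro surj_card_le) auto
  then show ?thesis by (simp add: card_cartesian_product)
qed

text \<open>Given that the triangles in \<open>F\<close> are present, the expected number of further triangles in \<open>{..<M}\<close> is
at most the subtracted term. Its first summand comes from the triangles that are edge-disjoint from
\<open>F\<close>, the second from those that share an edge with it.\<close>

lemma prob_exact_triangles:
  assumes "0 \<le> p" "p \<le> 1" "M \<le> n" "F \<in> disjoint_triples M k"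
  shows "p ^ (3 * k) * (1 - (real M ^ 3 * p ^ 3 / 6 + 3 * real k * real M * p\<^sup>2))
    \<le> measure_pmf.prob (gnp n p) {E. triangles E {..<M} = F}"
proof -
  define Tr where "Tr = {T. T \<subseteq> {..<M} \<and> card T = 3}"
  define Q where "Q = \<Union>(pairs ` F)"
  have finTr: "finite Tr" unfolding Tr_def by (rule finite_subset[of _ "Pow {..<M}"]) auto
  have F: "F \<subseteq> Tr" "disjoint F" "card F = k" "finite F" "\<And>A. A \<in> F \<Longrightarrow> card A = 3"
    using assms(4) disjoint_triples_finite unfolding disjoint_triples_def Tr_def by blast+
  have cQ: "card Q = 3 * k" unfolding Q_def using card_edges_disjoint_triples[OF F(4,2,5)] F(3) by simp
  have finp: "finite (pairs T)" if "T \<in> Tr" for T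
    using that finite_subset[of T "{..<M}"] by (simp add: Tr_def)
  have finQ: "finite Q" unfolding Q_def using F(1,4) finp by auto
  have pn: "pairs T \<subseteq> pairs {..<n}" if "T \<in> Tr" for T
    using that assms(3) by (intro pairs_mono) (auto simp: Tr_def)
  have Qn: "Q \<subseteq> pairs {..<n}" unfolding Q_def using pn F(1) by blast
  let ?prob = "measure_pmf.prob (gnp n p)"
  define Bad where "Bad = {T \<in> Tr - F. pairs T \<inter> Q \<noteq> {}}"
  define Free where "Free = {T \<in> Tr - F. pairs T \<inter> Q = {}}"
  have split: "Tr - F = Bad \<union> Free" "Bad \<inter> Free = {}" "finite Bad" "finite Free"
    using finTr by (auto simp: Bad_def Free_def)
  have cBad: "card Bad \<le> 3 * k * M"
  proof -
    have "card Bad \<le> card {T. T \<subseteq> {..<M} \<and> card T = 3 \<and> pairs T \<inter> Q \<noteq> {}}"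
      by (intro card_mono finite_subset[OF _ finTr]) (auto simp: Bad_def Tr_def)
    also have "\<dots> \<le> card Q * M" by (rule card_triples_containing_edge[OF finQ])
    finally show ?thesis by (simp add: cQ)
  qed
  have cFree: "real (card Free) \<le> real M ^ 3 / 6"
  proof -
    have "card Free \<le> card Tr" using finTr by (intro card_mono) (auto simp: Free_def)
    also have "\<dots> = M choose 3" by (simp add: Tr_def n_subsets)
    finally show ?thesis using choose_three_le[of M] by linarith
  qed
  have exact: "\<exists>T\<in>Tr - F. Q \<union> pairs T \<subseteq> E" if Q: "Q \<subseteq> E" and ne: "triangles E {..<M} \<noteq> F" for E
  proof -
    have "F \<subseteq> triangles E {..<M}"
    proof
      fix T assume "T \<in> F"
      then have "T \<in> Tr" "pairs T \<subseteq> E" using F(1) Q by (auto simp: Q_def)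
      then show "T \<in> triangles E {..<M}" by (simp add: triangles_iff Tr_def)
    qed
    then obtain T where "T \<in> triangles E {..<M}" "T \<notin> F" using ne by blast
    then show ?thesis using Q by (intro bexI[of _ T]) (auto simp: triangles_iff Tr_def)
  qed
  have "p ^ (3 * k) = ?prob {E. Q \<subseteq> E}" using prob_contains[OF assms(1,2) Qn] cQ by simp
  also have "\<dots> \<le> ?prob ({E. triangles E {..<M} = F} \<union> {E. \<exists>T\<in>Tr - F. Q \<union> pairs T \<subseteq> E})"
    using exact by (intro measure_pmf.finite_measure_mono) auto
  also have "\<dots> \<le> ?prob {E. triangles E {..<M} = F} + ?prob {E. \<exists>T\<in>Tr - F. Q \<union> pairs T \<subseteq> E}"
    by (rule measure_Un_le) auto
  also have "?prob {E. \<exists>T\<in>Tr - F. Q \<union> pairs T \<subseteq> E} \<le> (\<Sum>T\<in>Tr - F. p ^ card (Q \<union> pairs T))"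
    using pn Qn finTr by (intro prob_contains_some assms(1,2)) auto
  also have "\<dots> = (\<Sum>T\<in>Bad. p ^ card (Q \<union> pairs T)) + (\<Sum>T\<in>Free. p ^ card (Q \<union> pairs T))"
    unfolding split(1) by (rule sum.union_disjoint) (use split in auto)
  also have "(\<Sum>T\<in>Bad. p ^ card (Q \<union> pairs T)) \<le> (\<Sum>T\<in>Bad. p ^ (3 * k + 2))"
  proof (rule sum_mono)
    fix T assume T: "T \<in> Bad"
    then have T3: "T \<in> Tr" "card T = 3" "T \<notin> F" by (auto simp: Bad_def Tr_def)
    have "card (Q \<union> pairs T) + card (Q \<inter> pairs T) = 3 * k + 3"
      using card_Un_Int[OF finQ finp[OF T3(1)]] card_pairs_3[OF T3(2)] cQ by simp
    moreover have "card (Q \<inter> pairs T) \<le> 1"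
      using shared_edges_le_1[OF F(2) T3(2,3) F(5)] by (simp add: Q_def Int_commute)
    ultimately show "p ^ card (Q \<union> pairs T) \<le> p ^ (3 * k + 2)"
      using assms(1,2) by (intro power_decreasing) auto
  qed
  also have "(\<Sum>T\<in>Free. p ^ card (Q \<union> pairs T)) = (\<Sum>T\<in>Free. p ^ (3 * k + 3))"
  proof (rule sum.cong[OF refl])
    fix T assume T: "T \<in> Free"
    then have "T \<in> Tr" "card T = 3" "Q \<inter> pairs T = {}" by (auto simp: Free_def Tr_def)
    then show "p ^ card (Q \<union> pairs T) = p ^ (3 * k + 3)"
      using finQ finp cQ by (subst card_Un_disjoint) (auto simp: card_pairs_3)
  qed
  finally have "p ^ (3 * k) \<le> ?prob {E. triangles E {..<M} = F} +
      (real (card Bad) * p ^ (3 * k + 2) + real (card Free) * p ^ (3 * k + 3))" by simp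
  also have "real (card Bad) * p ^ (3 * k + 2) \<le> real (3 * k * M) * p ^ (3 * k + 2)"
    using assms(1) cBad by (intro mult_right_mono) (simp_all only: of_nat_le_iff zero_le_power)
  also have "real (card Free) * p ^ (3 * k + 3) \<le> real M ^ 3 / 6 * p ^ (3 * k + 3)"
    using assms(1) cFree by (intro mult_right_mono) auto
  finally show ?thesis by (simp add: algebra_simps power_add power2_eq_square power3_eq_cube)
qed

text \<open>The events that \<open>F\<close> is exactly the set of triangles in \<open>{..<M}\<close> exclude each other for different
\<open>F\<close>, so their probabilities may be added, and no second moment or correlation inequality
enters. Restricting to \<open>M < n\<close> vertices keeps the expected number of further triangles small even
when \<open>d\<close> is large.\<close>

lemma prob_many_triangles_ge:
  assumes "0 \<le> p" "p \<le> 1" "M \<le> n"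
  shows "(real ((M - 3 * k) choose 3) * p ^ 3) ^ k / fact k *
      (1 - (real M ^ 3 * p ^ 3 / 6 + 3 * real k * real M * p\<^sup>2))
    \<le> measure_pmf.prob (gnp n p) {E. k \<le> num_triangles E {..<n}}"
proof (cases "0 \<le> 1 - (real M ^ 3 * p ^ 3 / 6 + 3 * real k * real M * p\<^sup>2)")
  case True
  let ?prob = "measure_pmf.prob (gnp n p)"
  let ?c = "1 - (real M ^ 3 * p ^ 3 / 6 + 3 * real k * real M * p\<^sup>2)"
  let ?D = "disjoint_triples M k"
  have "((M - 3 * k) choose 3) ^ k \<le> card ?D * fact k" by (rule card_disjoint_triples_ge) simp
  then have "real (((M - 3 * k) choose 3) ^ k) \<le> real (card ?D * fact k)" by (simp only: of_nat_le_iff)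
  then have "real ((M - 3 * k) choose 3) ^ k / fact k \<le> real (card ?D)" by (simp add: field_simps)
  then have "real ((M - 3 * k) choose 3) ^ k / fact k * (p ^ (3 * k) * ?c) \<le> real (card ?D) * (p ^ (3 * k) * ?c)"
    using True assms(1) by (intro mult_right_mono mult_nonneg_nonneg) auto
  also have "\<dots> = (\<Sum>F\<in>?D. p ^ (3 * k) * ?c)" by simp
  also have "\<dots> \<le> (\<Sum>F\<in>?D. ?prob {E. triangles E {..<M} = F})"
    by (intro sum_mono prob_exact_triangles assms)
  also have "\<dots> = ?prob (\<Union>F\<in>?D. {E. triangles E {..<M} = F})"
    by (rule measure_pmf.finite_measure_finite_Union[symmetric])
       (auto simp: finite_disjoint_triples disjoint_family_on_def)
  also have "\<dots> = ?prob {E. triangles E {..<M} \<in> ?D}" by (rule arg_cong[of _ _ ?prob]) auto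
  also have "\<dots> \<le> ?prob {E. k \<le> num_triangles E {..<n}}"
  proof (rule prob_mono_on_graphs)
    fix E assume E: "E \<subseteq> pairs {..<n}" "triangles E {..<M} \<in> ?D"
    then have "k = card (triangles E {..<M})" by (simp add: disjoint_triples_def)
    also have "\<dots> \<le> card (triangles E {..<n})"
      using E assms(3) by (intro card_mono finite_triangles triangles_mono graph_of_gnp) auto
    finally show "k \<le> num_triangles E {..<n}" by (simp add: num_triangles_def)
  qed
  finally show ?thesis by (simp add: power_mult_distrib power_mult mult.assoc)
next
  case False
  then have "(real ((M - 3 * k) choose 3) * p ^ 3) ^ k / fact k *
      (1 - (real M ^ 3 * p ^ 3 / 6 + 3 * real k * real M * p\<^sup>2)) \<le> 0"
    using assms(1) by (intro mult_nonneg_nonpos divide_nonneg_nonneg zero_le_power mult_nonneg_nonneg) auto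
  then show ?thesis using measure_nonneg by (rule order_trans)
qed

section \<open>Costs of disjoint triangles and of cores\<close>

lemma power_over_fact_le_exp:
  fixes x :: real assumes "0 \<le> x" shows "x ^ s / fact s \<le> exp x"
proof -
  have "(\<Sum>i\<in>{s}. x ^ i /\<^sub>R fact i) \<le> (\<Sum>i. x ^ i /\<^sub>R fact i)"
    using assms exp_converges[of x] by (intro sum_le_suminf) (auto simp: sums_iff)
  then show ?thesis using exp_converges[of x] by (simp add: sums_iff field_simps)
qed

lemma choose_three_ge:
  assumes "2 \<le> m" shows "real (m - 2) ^ 3 / 6 \<le> real (m choose 3)"
proof -
  have "(m choose 3) * 6 = m * (m - 1) * (m - 2)"
  proof -
    obtain j where j: "m = j + 2" using assms by (metis add.commute le_Suc_ex)
    have two: "2 * (i + 2 choose 2) = (i + 2) * (i + 1)" for i :: nat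
      by (induction i) (simp_all add: numeral_2_eq_2)
    have "6 * (j + 2 choose 3) = (j + 2) * (j + 1) * j"
    proof (induction j)
      case (Suc j)
      have "(Suc j + 2 choose 3) = (j + 2 choose 2) + (j + 2 choose 3)"
        by (simp add: numeral_3_eq_3 numeral_2_eq_2)
      then have "6 * (Suc j + 2 choose 3) = 3 * (2 * (j + 2 choose 2)) + 6 * (j + 2 choose 3)" by linarith
      then show ?case unfolding two Suc by (simp add: algebra_simps)
    qed simp
    then show ?thesis by (simp add: j mult.commute)
  qed
  moreover have "(m - 2) ^ 3 \<le> m * (m - 1) * (m - 2)"
    unfolding power3_eq_cube by (intro mult_mono) auto
  ultimately have "(m - 2) ^ 3 \<le> (m choose 3) * 6" by simp
  then have "real ((m - 2) ^ 3) \<le> real ((m choose 3) * 6)" by (simp only: of_nat_le_iff)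
  then show ?thesis by simp
qed

lemma filterlim_ln_real: "filterlim (\<lambda>n::nat. ln (real n)) at_top sequentially"
  by (rule filterlim_compose[OF ln_at_top filterlim_real_sequentially])

text \<open>Here \<open>prob_many_triangles_ge\<close> is applied to a small constant proportion \<open>a\<close> of the vertices, with \<open>a\<close>
so small that the expected number of triangles among them is at most \<open>1 / 48\<close>. The choice of \<open>a\<close>
only affects the constant \<open>c\<close>, which is irrelevant against the factorial.\<close>

lemma eventually_prob_disjoint_ge:
  assumes d: "0 < d" and k: "\<forall>\<^sub>F n in sequentially. real (k n) \<le> real n powr (1/10)"
  obtains c where "0 < c" "c < 1"
    "\<forall>\<^sub>F n in sequentially. c ^ k n / (2 * fact (k n)) \<le> measure_pmf.prob (gnp n (d / real n)) {E. k n \<le> num_triangles E {..<n}}"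
proof -
  \<comment> \<open>Chosen so that \<open>a * d \<le> 1 / 2\<close>, which bounds the expected number of triangles by \<open>1 / 48\<close>.\<close>
  define a where "a = min 1 (1 / d) / 2"
  have a: "0 < a" "a \<le> 1" "a * d \<le> 1 / 2"
    using d by (auto simp: a_def min_def field_simps)
  define c where "c = (a * d / 2) ^ 3 / 6"
  have c: "0 < c" "c < 1"
  proof -
    show "0 < c" using a d by (simp add: c_def)
    have "(a * d / 2) ^ 3 \<le> 1 ^ 3" using a d by (intro power_mono) auto
    then show "c < 1" by (simp add: c_def)
  qed
  have "((\<lambda>n::nat. real n powr (1/10) / real n) \<longlongrightarrow> 0) sequentially" by real_asymp
  then have "((\<lambda>n. 3 * d^2 * (real n powr (1/10) / real n)) \<longlongrightarrow> 3 * d^2 * 0) sequentially"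
    by (intro tendsto_intros)
  then have e1: "\<forall>\<^sub>F n in sequentially. 3 * d^2 * (real n powr (1/10) / real n) < 1/4"
    by (intro order_tendstoD(2)) auto
  have "filterlim (\<lambda>n::nat. a / 2 * real n - (3 * real n powr (1/10) + 3)) at_top sequentially"
    using a(1) by real_asymp
  then have e2: "\<forall>\<^sub>F n in sequentially. 0 \<le> a / 2 * real n - (3 * real n powr (1/10) + 3)"
    unfolding filterlim_at_top by (rule spec)
  have e3: "\<forall>\<^sub>F n in sequentially. d \<le> real n"
    using filterlim_real_sequentially by (simp add: filterlim_at_top)
  have "\<forall>\<^sub>F n in sequentially. c ^ k n / (2 * fact (k n)) \<le> measure_pmf.prob (gnp n (d / real n)) {E. k n \<le> num_triangles E {..<n}}"
    using k e1 e2 e3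
  proof eventually_elim
    case (elim n)
    define p where "p = d / real n"
    define M where "M = nat \<lfloor>a * real n\<rfloor>"
    have n: "0 < real n" using elim(4) d by linarith
    have p: "0 \<le> p" "p \<le> 1" using d n elim(4) by (auto simp: p_def)
    have M: "real M \<le> a * real n" "a * real n - 1 \<le> real M"
      using a n by (auto simp: M_def of_nat_nat)
    have Mn: "M \<le> n"
    proof -
      have "real M \<le> 1 * real n" using M(1) a(2) n by (meson mult_right_mono order_trans less_imp_le)
      then show ?thesis by simp
    qed
    have big: "a / 2 * real n \<le> real M - 3 * real (k n) - 2" using M(2) elim(1,3) by linarith
    have "0 < a / 2 * real n" using a n by simp
    then have "3 * k n + 2 \<le> M" using big by linarith
    then have eqM: "real (M - 3 * k n - 2) = real M - 3 * real (k n) - 2" "2 \<le> M - 3 * k n"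
      by (auto simp: of_nat_diff)
    have "c = (a / 2 * real n) ^ 3 / 6 * p ^ 3" using n by (simp add: c_def p_def field_simps)
    also have "\<dots> \<le> real (M - 3 * k n - 2) ^ 3 / 6 * p ^ 3"
      unfolding eqM using big p a n by (intro mult_right_mono divide_right_mono power_mono) auto
    also have "\<dots> \<le> real ((M - 3 * k n) choose 3) * p ^ 3"
      using p choose_three_ge[OF eqM(2)] by (intro mult_right_mono) auto
    finally have C: "c \<le> real ((M - 3 * k n) choose 3) * p ^ 3" .
    have b1: "real M ^ 3 * p ^ 3 / 6 \<le> 1 / 48"
    proof -
      have "real M * p \<le> a * real n * p" using M p by (intro mult_right_mono) auto
      also have "\<dots> \<le> 1 / 2" using a(3) n by (simp add: p_def)
      finally have "(real M * p) ^ 3 \<le> (1 / 2) ^ 3" using p by (intro power_mono) auto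
      then show ?thesis unfolding power_mult_distrib by (simp add: power_divide mult.commute)
    qed
    have b2: "3 * real (k n) * real M * p\<^sup>2 \<le> 1 / 4"
    proof -
      have "3 * real (k n) * real M * p\<^sup>2 \<le> 3 * real n powr (1/10) * real n * p\<^sup>2"
        using elim(1) Mn p by (intro mult_mono mult_right_mono) auto
      also have "\<dots> = 3 * d^2 * (real n powr (1/10) / real n)"
        using n by (simp add: p_def power_divide power2_eq_square)
      finally show ?thesis using elim(2) by linarith
    qed
    have "c ^ k n / (2 * fact (k n)) = c ^ k n / fact (k n) * (1 / 2)" by simp
    also have "\<dots> \<le> (real ((M - 3 * k n) choose 3) * p ^ 3) ^ k n / fact (k n) *
      (1 - (real M ^ 3 * p ^ 3 / 6 + 3 * real (k n) * real M * p\<^sup>2))"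
      using C c b1 b2 p by (intro mult_mono divide_right_mono power_mono) auto
    also have "\<dots> \<le> measure_pmf.prob (gnp n p) {E. k n \<le> num_triangles E {..<n}}"
      by (rule prob_many_triangles_ge[OF p Mn])
    finally show ?case by (simp add: p_def)
  qed
  then show ?thesis using c that by blast
qed

text \<open>The probability \<open>D ^ s / fact s\<close> of \<open>s\<close> disjoint triangles against the cost \<open>K ln K\<close> of \<open>K\<close> of them.
If \<open>s\<close> is at least a constant proportion of \<open>K\<close> then \<open>ln s\<close> is almost \<open>ln K\<close>, so the cost is
almost proportional; if \<open>s\<close> is smaller, the term \<open>2 * \<epsilon>'\<close> makes the claim trivial. The cost may be
replaced by any smaller \<open>Y\<close>, which serves to truncate it at a multiple of the cost of a clique.\<close>

lemma power_over_fact_le_cost: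
  fixes D \<epsilon>' K Y a :: real
  assumes D: "0 < D" and e: "0 < \<epsilon>'" "\<epsilon>' < 1" and K: "exp 1 * D / \<epsilon>' \<le> K powr \<epsilon>'" "1 \<le> K"
    and s: "(a - \<epsilon>') * K \<le> real s" and a: "a \<le> 1" and Y: "0 \<le> Y" "Y \<le> K * ln K"
  shows "D ^ s / fact s \<le> exp (D - (a - 2 * \<epsilon>') * Y)"
proof (cases "a \<le> 2 * \<epsilon>'")
  case True
  have "D ^ s / fact s \<le> exp D" using D by (intro power_over_fact_le_exp) auto
  also have "\<dots> \<le> exp (D - (a - 2 * \<epsilon>') * Y)" using True Y by (simp add: mult_nonpos_nonneg)
  finally show ?thesis .
next
  case False
  \<comment> \<open>Splitting off \<open>q ^ s / fact s \<le> exp q\<close> replaces Stirling's formula; \<open>q \<le> s\<close> is of the order of \<open>K\<close>.\<close>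
  define q where "q = \<epsilon>' * K"
  have q: "0 < q" using e K by (simp add: q_def)
  have "q \<le> (a - \<epsilon>') * K" unfolding q_def using False K by (intro mult_right_mono) auto
  then have qs: "q \<le> real s" using s by linarith
  have lnK: "0 \<le> ln K" using K by simp
  have "D ^ s / fact s = (D / q) ^ s * (q ^ s / fact s)" using q by (simp add: power_divide)
  also have "\<dots> \<le> (D / q) ^ s * exp q" using q D by (intro mult_left_mono power_over_fact_le_exp) auto
  also have "\<dots> \<le> (D / q) ^ s * exp (real s)" using q D qs by (intro mult_left_mono) auto
  also have "\<dots> = (exp 1 * D / \<epsilon>' / K) ^ s"
    by (simp add: q_def power_divide power_mult_distrib exp_of_nat_mult[of s 1, symmetric] mult.commute flip: exp_of_nat_mult)
  also have "\<dots> \<le> (K powr \<epsilon>' / K) ^ s"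
    using D e K by (intro power_mono divide_right_mono) auto
  also have "K powr \<epsilon>' / K = K powr (\<epsilon>' - 1)" using K by (simp add: powr_diff)
  also have "\<dots> = exp (- ((1 - \<epsilon>') * ln K))" using K by (simp add: powr_def algebra_simps)
  also have "exp (- ((1 - \<epsilon>') * ln K)) ^ s = exp (- (real s * ((1 - \<epsilon>') * ln K)))"
    by (simp add: exp_of_nat_mult[symmetric])
  also have "\<dots> \<le> exp (- ((a - 2 * \<epsilon>') * Y))"
  proof -
    have "(a - 2 * \<epsilon>') * Y \<le> (a - 2 * \<epsilon>') * (K * ln K)" using False Y by (intro mult_left_mono) auto
    also have "\<dots> \<le> ((a - \<epsilon>') * (1 - \<epsilon>')) * (K * ln K)"
    proof (rule mult_right_mono)
      have "\<epsilon>' * (a - \<epsilon>') \<le> \<epsilon>' * 1" using a e by (intro mult_left_mono) auto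
      then show "a - 2 * \<epsilon>' \<le> (a - \<epsilon>') * (1 - \<epsilon>')" by (simp add: algebra_simps)
    qed (use K in auto)
    also have "\<dots> = ((a - \<epsilon>') * K) * ((1 - \<epsilon>') * ln K)" by simp
    also have "\<dots> \<le> real s * ((1 - \<epsilon>') * ln K)" using s e lnK by (intro mult_right_mono) auto
    finally show ?thesis by simp
  qed
  also have "\<dots> \<le> exp (D - (a - 2 * \<epsilon>') * Y)" using D by simp
  finally show ?thesis .
qed

text \<open>A clique on \<open>w\<close> vertices has about \<open>w ^ 3 / 6\<close> triangles and \<open>w ^ 2 / 2\<close> edges; the exponent \<open>2/3\<close> is
the scaling of edges against triangles.\<close>

lemma card_ge_of_triangles:
  assumes "graph H" "0 \<le> \<tau>" "0 < w" "\<tau> * w ^ 3 / 6 \<le> real (card (triangles H UNIV))"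
  shows "\<tau> powr (2/3) * (w ^ 2 / 2) \<le> real (card H)"
proof (cases "card H = 0")
  case True
  then have "H = {}" using graph_finite[OF assms(1)] by simp
  then have "triangles H UNIV = {}" using triangle_subset_Union[of _ "{}" UNIV] by (fastforce simp: triangles_iff)
  then have "\<tau> * w ^ 3 \<le> 0" using assms(4) by simp
  then have "\<tau> = 0" using assms(2,3) by (simp add: mult_le_0_iff)
  then show ?thesis by simp
next
  case False
  define m where "m = real (card H)"
  have m: "0 < m" using False by (simp add: m_def)
  have "3 * real (card (triangles H UNIV)) \<le> sqrt (2 * m) * m"
    unfolding m_def using False by (intro triangle_count_le assms) auto
  then have "\<tau> * w ^ 3 / 2 \<le> sqrt (2 * m) * m" using assms(4) by simp
  then have "(\<tau> * w ^ 3 / 2) ^ 2 \<le> (sqrt (2 * m) * m) ^ 2" using assms(2,3) by (intro power_mono) auto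
  also have "\<dots> = 2 * m ^ 3" using m by (simp add: power_mult_distrib power2_eq_square power3_eq_cube)
  finally have le: "\<tau> ^ 2 * w ^ 6 / 8 \<le> m ^ 3" by (simp add: power_mult_distrib power_divide flip: power_mult)
  have "(\<tau> powr (2/3) * (w ^ 2 / 2)) ^ 3 = \<tau> ^ 2 * w ^ 6 / 8"
  proof -
    have "(\<tau> powr (2/3)) ^ 3 = \<tau> ^ 2"
    proof (cases "\<tau> = 0")
      case False
      then show ?thesis using assms(2) by (simp add: powr_power powr_numeral)
    qed simp
    then show ?thesis by (simp add: power_mult_distrib power_divide flip: power_mult)
  qed
  then have "(\<tau> powr (2/3) * (w ^ 2 / 2)) ^ 3 \<le> m ^ 3" using le by simp
  then show ?thesis unfolding m_def[symmetric]
    using m by (subst (asm) power_mono_iff) auto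
qed

text \<open>This is \<open>near_extremal_cluster\<close> with \<open>\<beta> = \<epsilon> / 4\<close>. A relative error \<open>\<epsilon>\<^sup>2 / 100\<close> in edges and triangles
makes the slack \<open>W ^ 3 / 2 - 3 t\<close> of order \<open>\<epsilon>\<^sup>2\<close>, and dividing by \<open>\<beta>\<close> leaves less than \<open>\<epsilon>\<close>.\<close>

lemma cluster_of_few_edges:
  assumes "graph H" "0 < \<epsilon>" "\<epsilon> < 1" "0 < w"
    "2 * real (card H) \<le> (1 + \<epsilon>\<^sup>2 / 100) * w\<^sup>2"
    "(1 - \<epsilon>\<^sup>2 / 100) * (w ^ 3 / 6) \<le> real (card (triangles H UNIV))"
  obtains V where "V \<subseteq> \<Union>H" "real (card V) \<le> (1 + \<epsilon>) * w"
    "(1 - \<epsilon>) * (w ^ 3 / 6) \<le> real (card (triangles H V))"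
proof -
  define e where "e = \<epsilon>\<^sup>2 / 100"
  have e: "0 < e" "e \<le> \<epsilon> / 100" "e \<le> 1 / 100"
    using assms(2,3) power_le_one[of \<epsilon> 2] by (auto simp: e_def power2_eq_square)
  define W where "W = sqrt (1 + e) * w"
  have W: "0 < W" "W\<^sup>2 = (1 + e) * w\<^sup>2" using assms(4) e by (auto simp: W_def power_mult_distrib)
  have sq: "sqrt (1 + e) \<le> 1 + e" using e by (intro real_le_lsqrt) (auto simp: power2_eq_square algebra_simps)
  let ?t = "real (card (triangles H UNIV))"
  obtain V where V: "V \<subseteq> \<Union>H" "(1 - \<epsilon>/4) * real (card V) \<le> W"
    "\<epsilon>/4 * (?t - real (card (triangles H V))) \<le> W ^ 3 / 2 - 3 * ?t"
    using near_extremal_cluster[of H W "\<epsilon>/4"] assms W by (auto simp: e_def)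
  have "W \<le> (1 + e) * w" unfolding W_def using sq assms(4) by (intro mult_right_mono) auto
  also have "\<dots> \<le> ((1 - \<epsilon>/4) * (1 + \<epsilon>)) * w"
  proof (rule mult_right_mono)
    have "\<epsilon> * \<epsilon> \<le> \<epsilon> * 1" using assms(2,3) by (intro mult_left_mono) auto
    moreover have "(1 - \<epsilon>/4) * (1 + \<epsilon>) = 1 + 3/4 * \<epsilon> - (\<epsilon> * \<epsilon>) / 4" by (simp add: field_simps)
    ultimately show "1 + e \<le> (1 - \<epsilon>/4) * (1 + \<epsilon>)" using e assms(2) by linarith
  qed (use assms in auto)
  finally have "(1 - \<epsilon>/4) * real (card V) \<le> (1 - \<epsilon>/4) * ((1 + \<epsilon>) * w)" using V(2) by simp
  then have 1: "real (card V) \<le> (1 + \<epsilon>) * w" using assms(3) by simp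
  define K where "K = w ^ 3 / 6"
  have K: "0 < K" using assms(4) by (simp add: K_def)
  have "W ^ 3 = (W\<^sup>2) * W" by (simp add: power3_eq_cube power2_eq_square)
  also have "\<dots> \<le> ((1 + e) * w\<^sup>2) * ((1 + e) * w)"
    unfolding W(2) using \<open>W \<le> (1 + e) * w\<close> e by (intro mult_left_mono) auto
  also have "\<dots> = (1 + e)\<^sup>2 * (6 * K)" by (simp add: K_def power3_eq_cube power2_eq_square)
  also have "\<dots> \<le> (1 + 3 * e) * (6 * K)"
  proof (rule mult_right_mono)
    have "e * e \<le> e * 1" using e by (intro mult_left_mono) auto
    then show "(1 + e)\<^sup>2 \<le> 1 + 3 * e" by (simp add: power2_eq_square algebra_simps)
  qed (use K in auto)
  finally have W3: "W ^ 3 / 2 \<le> 3 * K + 9 * (e * K)" by (simp add: algebra_simps)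
  have t: "K - e * K \<le> ?t" using assms(6) by (simp add: e_def K_def algebra_simps)
  have "\<epsilon>/4 * (?t - real (card (triangles H V))) \<le> 12 * (e * K)" using V(3) W3 t by linarith
  also have "\<dots> = \<epsilon>/4 * (48/100 * (\<epsilon> * K))" by (simp add: e_def power2_eq_square)
  finally have "?t - real (card (triangles H V)) \<le> 48/100 * (\<epsilon> * K)" using assms(2) by (simp add: mult.commute)
  moreover have "e * K \<le> \<epsilon> / 100 * K" using e K by (intro mult_right_mono) auto
  moreover have "0 \<le> \<epsilon> * K" using K assms(2) by simp
  ultimately have "(1 - \<epsilon>) * K \<le> real (card (triangles H V))" using t by (simp add: algebra_simps)
  then show ?thesis using that[OF V(1) 1] by (simp add: K_def)
qed

text \<open>A quantitative form of strict concavity on the unit interval.\<close>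

lemma concave_gap:
  fixes \<tau> :: real assumes "0 \<le> \<tau>" "\<tau> \<le> 1"
  shows "\<tau> + \<tau> * (1 - \<tau>) / 3 \<le> \<tau> powr (2/3)"
proof -
  \<comment> \<open>In terms of the cube root \<open>y\<close> the gap is \<open>y\<^sup>2 * (1 - y)\<close>.\<close>
  define y where "y = \<tau> powr (1/3)"
  have y: "0 \<le> y" "y \<le> 1" using assms by (auto simp: y_def intro: powr_le1)
  have y3: "y ^ 3 = \<tau>" using assms by (cases "\<tau> = 0") (auto simp: y_def powr_power)
  have y2: "y ^ 2 = \<tau> powr (2/3)" using assms by (cases "\<tau> = 0") (auto simp: y_def powr_power)
  have "y ^ 3 \<le> y ^ 2" using y by (intro power_decreasing) auto
  have "1 - y ^ 3 = (1 - y) * (1 + y + y ^ 2)" by (simp add: power2_eq_square power3_eq_cube algebra_simps)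
  also have "\<dots> \<le> (1 - y) * 3" using y power_le_one[of y 2] by (intro mult_left_mono) auto
  finally have "\<tau> * (1 - \<tau>) \<le> y ^ 2 * ((1 - y) * 3)"
    using \<open>y ^ 3 \<le> y ^ 2\<close> y3 assms y by (intro mult_mono) auto
  also have "\<dots> = 3 * (y ^ 2 - y ^ 3)" by (simp add: power2_eq_square power3_eq_cube algebra_simps)
  finally show ?thesis using y2 y3 by simp
qed

section \<open>The two costs and the first-order probability of many triangles\<close>

text \<open>The number of vertices of a clique with \<open>k\<close> triangles, to first order.\<close>

definition side :: "nat \<Rightarrow> real" where
  "side k = (6 * real k) powr (1/3)"

text \<open>The order of \<open>- ln\<close> of the probability of a clique on \<open>side k\<close> given vertices. Choosing the
vertices contributes only \<open>O(side k * ln n)\<close>, which is of lower order.\<close>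

definition clique_cost :: "nat \<Rightarrow> nat \<Rightarrow> real" where
  "clique_cost n k = (side k)\<^sup>2 / 2 * ln (real n)"

lemma side_cubed: "side k ^ 3 = 6 * real k"
  by (cases "k = 0") (auto simp: side_def powr_power)

lemma side_squared: "side k ^ 2 = (6 * real k) powr (2/3)"
  by (cases "k = 0") (auto simp: side_def powr_power)

lemma side_ge_1: "1 \<le> k \<Longrightarrow> 1 \<le> side k"
  unfolding side_def by (intro ge_one_powr_ge_zero) auto

lemma side_le: "1 \<le> k \<Longrightarrow> side k \<le> 6 * real k"
  unfolding side_def using powr_mono[of "1/3" 1 "6 * real k"] by simp

text \<open>The case of an unbounded sequence \<open>k\<close>, in which all error terms are small against the cost of a
clique.\<close>

locale growing_triangle_count =
  fixes d :: real and k :: "nat \<Rightarrow> nat"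
  assumes d_pos: "0 < d"
    and k_top: "filterlim k at_top sequentially"
    and k_le: "\<forall>\<^sub>F n in sequentially. real (k n) \<le> real n powr (1/10)"
begin

abbreviation "w n \<equiv> side (k n)"
abbreviation "U n \<equiv> clique_cost n (k n)"
abbreviation "many n \<equiv> measure_pmf.prob (gnp n (d / real n)) {E. k n \<le> num_triangles E {..<n}}"

lemma real_k_top: "filterlim (\<lambda>n. real (k n)) at_top sequentially"
  using filterlim_compose[OF filterlim_real_sequentially k_top] by simp

lemma k_ge: "\<forall>\<^sub>F n in sequentially. c \<le> k n"
  using k_top unfolding filterlim_at_top by blast

lemma w_top: "filterlim w at_top sequentially"
proof -
  have "filterlim (\<lambda>x::real. (6 * x) powr (1/3)) at_top at_top" by real_asymp
  from filterlim_compose[OF this real_k_top] show ?thesis by (simp add: side_def)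
qed

lemma n_ge: "\<forall>\<^sub>F n::nat in sequentially. c \<le> real n"
  using filterlim_real_sequentially unfolding filterlim_at_top by blast

text \<open>All error terms below have this shape: choices of \<open>O(w)\<close> vertices, of edges among them, and
constants.\<close>

lemma absorb:
  assumes "0 < \<eta>"
  shows "\<forall>\<^sub>F n in sequentially. A * w n * ln (real n) + B * (w n)\<^sup>2 + C \<le> \<eta> * U n"
proof -
  have 1: "((\<lambda>n. inverse (w n)) \<longlongrightarrow> 0) sequentially"
    using filterlim_compose[OF tendsto_inverse_0_at_top[OF filterlim_ident] w_top] by simp
  have 2: "((\<lambda>n. inverse (ln (real n))) \<longlongrightarrow> 0) sequentially"
    using filterlim_compose[OF tendsto_inverse_0_at_top[OF filterlim_ident] filterlim_ln_real] by simp
  have "((\<lambda>n. 2 * A * inverse (w n) + 2 * B * inverse (ln (real n)) + 2 * C * (inverse (w n))\<^sup>2 * inverse (ln (real n)))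
     \<longlongrightarrow> 2 * A * 0 + 2 * B * 0 + 2 * C * 0\<^sup>2 * 0) sequentially"
    by (intro tendsto_intros 1 2)
  then have "\<forall>\<^sub>F n in sequentially. 2 * A * inverse (w n) + 2 * B * inverse (ln (real n)) + 2 * C * (inverse (w n))\<^sup>2 * inverse (ln (real n)) < \<eta>"
    using assms by (intro order_tendstoD(2)) auto
  moreover have "\<forall>\<^sub>F n in sequentially. 0 < w n" using w_top unfolding filterlim_at_top_dense by blast
  moreover have "\<forall>\<^sub>F n in sequentially. 0 < ln (real n)" using filterlim_ln_real unfolding filterlim_at_top_dense by blast
  ultimately show ?thesis
  proof eventually_elim
    case (elim n)
    have U: "0 < U n" using elim by (simp add: clique_cost_def)
    have "(2 * A * inverse (w n) + 2 * B * inverse (ln (real n)) + 2 * C * (inverse (w n))\<^sup>2 * inverse (ln (real n))) * U n \<le> \<eta> * U n"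
      using elim U by (intro mult_right_mono) auto
    also have "(2 * A * inverse (w n) + 2 * B * inverse (ln (real n)) + 2 * C * (inverse (w n))\<^sup>2 * inverse (ln (real n))) * U n
      = A * w n * ln (real n) + B * (w n)\<^sup>2 + C"
      using elim by (simp add: clique_cost_def field_simps power2_eq_square)
    finally show ?case .
  qed
qed

lemma U_top: "filterlim U at_top sequentially"
proof -
  have "\<forall>\<^sub>F n in sequentially. 2 \<le> w n" using w_top unfolding filterlim_at_top by blast
  moreover have "\<forall>\<^sub>F n in sequentially. 0 \<le> ln (real n)" using filterlim_ln_real unfolding filterlim_at_top by blast
  ultimately have "\<forall>\<^sub>F n in sequentially. ln (real n) \<le> U n"
  proof eventually_elim
    case (elim n)
    then have "2\<^sup>2 \<le> (w n)\<^sup>2" by (intro power_mono) auto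
    then have "1 * ln (real n) \<le> (w n)\<^sup>2 / 2 * ln (real n)" using elim by (intro mult_right_mono) auto
    then show ?case by (simp add: clique_cost_def)
  qed
  then show ?thesis by (rule filterlim_at_top_mono[OF filterlim_ln_real])
qed

text \<open>The clique is put on fixed vertices; rounding \<open>w\<close> up to an integer and the constant factor \<open>d\<close> in the
edge probability only contribute terms covered by \<open>absorb\<close>.\<close>

lemma many_ge_clique:
  assumes "0 < \<eta>"
  shows "\<forall>\<^sub>F n in sequentially. exp (- (1 + \<eta>) * U n) \<le> many n"
proof -
  have "filterlim (\<lambda>n::nat. real n - (6 * real n powr (1/10) + 4)) at_top sequentially" by real_asymp
  then have e: "\<forall>\<^sub>F n::nat in sequentially. 0 \<le> real n - (6 * real n powr (1/10) + 4)"
    unfolding filterlim_at_top by (rule spec)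
  show ?thesis using absorb[OF assms, of 8 "8 * \<bar>ln d\<bar>" 0] k_ge[of 1] k_le e n_ge[of "max 1 d"]
  proof eventually_elim
    case (elim n)
    have w1: "1 \<le> w n" using side_ge_1 elim(2) .
    \<comment> \<open>The summand \<open>2\<close> compensates that \<open>m choose 3\<close> is only bounded below by \<open>(m - 2) ^ 3 / 6\<close>.\<close>
    define m where "m = nat \<lceil>w n\<rceil> + 2"
    have m: "w n + 2 \<le> real m" "real m \<le> w n + 3" using w1 unfolding m_def by linarith+
    have "w n \<le> 6 * real (k n)" using elim(2) by (rule side_le)
    then have mn: "m \<le> n" using m elim(3,4) by linarith
    have n: "1 \<le> real n" "d \<le> real n" using elim(5) by auto
    define p where "p = d / real n"
    have p: "0 < p" "p \<le> 1" using n d_pos by (auto simp: p_def)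
    have "real (k n) = w n ^ 3 / 6" by (simp add: side_cubed)
    also have "\<dots> \<le> real (m - 2) ^ 3 / 6"
      using m w1 by (intro divide_right_mono power_mono) (auto simp: m_def)
    also have "\<dots> \<le> real (m choose 3)" by (rule choose_three_ge) (simp add: m_def)
    finally have km: "k n \<le> m choose 3" by simp
    have c2: "real (m choose 2) \<le> (w n + 3)\<^sup>2 / 2"
    proof -
      have "2 * (m choose 2) \<le> m * (m - 1)" unfolding choose_two by (rule times_div_less_eq_dividend)
      also have "\<dots> \<le> m * m" by simp
      finally have "2 * (m choose 2) \<le> m * m" .
      then have "real (2 * (m choose 2)) \<le> real (m * m)" by (simp only: of_nat_le_iff)
      moreover have "real m * real m \<le> (w n + 3) * (w n + 3)" using m w1 by (intro mult_mono) auto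
      ultimately show ?thesis by (simp add: power2_eq_square)
    qed
    have lnp: "- ln p \<le> ln (real n) + \<bar>ln d\<bar>" "0 \<le> - ln p"
      using n p d_pos by (auto simp: p_def ln_div)
    have "real (m choose 2) * (- ln p) \<le> (w n + 3)\<^sup>2 / 2 * (- ln p)" using lnp c2 by (intro mult_right_mono) auto
    also have "\<dots> \<le> (w n + 3)\<^sup>2 / 2 * (ln (real n) + \<bar>ln d\<bar>)" using lnp by (intro mult_left_mono) auto
    also have "\<dots> = U n + (6 * w n + 9) / 2 * ln (real n) + (w n + 3)\<^sup>2 / 2 * \<bar>ln d\<bar>"
      by (simp add: clique_cost_def power2_eq_square field_simps)
    also have "\<dots> \<le> U n + 8 * w n * ln (real n) + 8 * (w n)\<^sup>2 * \<bar>ln d\<bar>"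
    proof (intro add_mono mult_right_mono order_refl)
      have "(w n + 3)\<^sup>2 \<le> (4 * w n)\<^sup>2" using w1 by (intro power_mono) auto
      then show "(w n + 3)\<^sup>2 / 2 \<le> 8 * (w n)\<^sup>2" by (simp add: power_mult_distrib)
    qed (use w1 n in auto)
    also have "\<dots> \<le> U n + \<eta> * U n" using elim(1) by (simp add: algebra_simps)
    finally have "- (1 + \<eta>) * U n \<le> real (m choose 2) * ln p" by (simp add: algebra_simps)
    then have "exp (- (1 + \<eta>) * U n) \<le> exp (real (m choose 2) * ln p)" by simp
    also have "\<dots> = p ^ (m choose 2)" using p by (simp add: exp_of_nat_mult)
    also have "\<dots> \<le> measure_pmf.prob (gnp n p) {E. k n \<le> num_triangles E {..<n}}"
      using p mn km by (intro prob_clique) auto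
    finally show ?case by (simp add: p_def)
  qed
qed

lemma many_ge_disjoint:
  assumes "0 < \<eta>"
  shows "\<forall>\<^sub>F n in sequentially. exp (- (1 + \<eta>) * (real (k n) * ln (real (k n)))) \<le> many n"
proof -
  obtain c where c: "0 < c" "c < 1"
    and ev: "\<forall>\<^sub>F n in sequentially. c ^ k n / (2 * fact (k n)) \<le> many n"
    using eventually_prob_disjoint_ge[OF d_pos k_le] by blast
  have "filterlim (\<lambda>n. ln (real (k n))) at_top sequentially"
    by (rule filterlim_compose[OF ln_at_top real_k_top])
  then have "\<forall>\<^sub>F n in sequentially. (1 - ln c) / \<eta> \<le> ln (real (k n))" unfolding filterlim_at_top by blast
  then show ?thesis using ev k_ge[of 1]
  proof eventually_elim
    case (elim n)
    have k1: "1 \<le> real (k n)" using elim(3) by simp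
    have "1 - ln c \<le> \<eta> * ln (real (k n))" using elim(1) assms by (simp add: field_simps)
    then have "real (k n) * (1 - ln c) \<le> real (k n) * (\<eta> * ln (real (k n)))" using k1 by (intro mult_left_mono) auto
    moreover have "ln 2 \<le> (1::real)" using ln_2_less_1 by simp
    ultimately have "- (1 + \<eta>) * (real (k n) * ln (real (k n))) \<le> real (k n) * ln c - ln 2 - real (k n) * ln (real (k n))"
      using k1 by (simp add: algebra_simps)
    then have "exp (- (1 + \<eta>) * (real (k n) * ln (real (k n)))) \<le> exp (real (k n) * ln c - ln 2 - real (k n) * ln (real (k n)))"
      by simp
    also have "\<dots> = c ^ k n / (2 * real (k n) ^ k n)"
      using c k1 by (simp add: exp_diff exp_of_nat_mult)
    also have "\<dots> \<le> c ^ k n / (2 * fact (k n))"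
      using c k1 fact_le_power[of "k n", where 'a = real] by (intro divide_left_mono) auto
    finally show ?case using elim(2) by linarith
  qed
qed

definition min_cost :: "nat \<Rightarrow> real" where
  "min_cost n = min (U n) (real (k n) * ln (real (k n)))"

lemma U_pos: "\<forall>\<^sub>F n in sequentially. 0 < U n"
  using U_top unfolding filterlim_at_top_dense by blast

lemma many_ge:
  assumes "0 < \<eta>"
  shows "\<forall>\<^sub>F n in sequentially. exp (- (min_cost n + \<eta> * U n)) \<le> many n"
  using many_ge_clique[OF assms] many_ge_disjoint[OF assms] U_pos
proof eventually_elim
  case (elim n)
  show ?case
  proof (cases "U n \<le> real (k n) * ln (real (k n))")
    case True
    then have "- (min_cost n + \<eta> * U n) = - (1 + \<eta>) * U n" by (simp add: min_cost_def algebra_simps)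
    then show ?thesis using elim(1) by simp
  next
    case False
    then have "\<eta> * (real (k n) * ln (real (k n))) \<le> \<eta> * U n" using assms by (intro mult_left_mono) auto
    then have "- (min_cost n + \<eta> * U n) \<le> - (1 + \<eta>) * (real (k n) * ln (real (k n)))"
      using False by (simp add: min_cost_def algebra_simps)
    then have "exp (- (min_cost n + \<eta> * U n)) \<le> exp (- (1 + \<eta>) * (real (k n) * ln (real (k n))))" by simp
    then show ?thesis using elim(2) by linarith
  qed
qed

text \<open>The excess of linked triangles that is ruled out. The factor \<open>20\<close> makes
\<open>prob_has_excess_le\<close> smaller than the probability of the clique.\<close>

definition cap :: "nat \<Rightarrow> nat" where "cap n = nat \<lceil>20 * (w n)\<^sup>2\<rceil>"

lemma cap_bounds:
  assumes "1 \<le> k n" shows "20 * (w n)\<^sup>2 \<le> real (cap n)" "real (cap n) \<le> 21 * (w n)\<^sup>2" "1 \<le> cap n"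
proof -
  have "1 \<le> (w n)\<^sup>2" using side_ge_1[OF assms] by simp
  then show "20 * (w n)\<^sup>2 \<le> real (cap n)" "real (cap n) \<le> 21 * (w n)\<^sup>2" "1 \<le> cap n"
    unfolding cap_def by linarith+
qed

text \<open>From \<open>k \<le> n\<^sup>1\<^sup>/\<^sup>1\<^sup>0\<close> follows \<open>w\<^sup>2 = O(n\<^sup>1\<^sup>/\<^sup>1\<^sup>5)\<close>. So the base in \<open>prob_excess_le\<close> is \<open>O(n\<^sup>1\<^sup>4\<^sup>/\<^sup>1\<^sup>5) / n\<close>, which is
at most \<open>n\<close> to the power \<open>- 1 / 20\<close>, and raising it to the power \<open>20 w\<^sup>2\<close> gives \<open>exp (- 2 U)\<close>.\<close>

lemma prob_has_excess_le:
  "\<forall>\<^sub>F n in sequentially. measure_pmf.prob (gnp n (d / real n)) {E. has_excess (cap n) E} \<le> exp (- 2 * U n)"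
proof -
  define c where "c = (50 * 126\<^sup>2 * max 1 d) ^ 7"
  have c: "0 < c" by (simp add: c_def)
  have "\<forall>\<^sub>F n::nat in sequentially. c * real n powr (14/15) / real n \<le> real n powr (-1/20)"
    using c by real_asymp
  then show ?thesis using k_ge[of 1] k_le n_ge[of "max 1 d"]
  proof eventually_elim
    case (elim n)
    have n: "1 \<le> real n" "d \<le> real n" using elim(4) by auto
    have "(w n)\<^sup>2 \<le> (6 * real n powr (1/10)) powr (2/3)"
      unfolding side_squared using elim(3) by (intro powr_mono2) auto
    also have "\<dots> = 6 powr (2/3) * real n powr (1/15)" using n by (simp add: powr_mult powr_powr)
    also have "\<dots> \<le> 6 powr 1 * real n powr (1/15)" by (intro mult_right_mono powr_mono) auto
    finally have "real (cap n) \<le> 126 * real n powr (1/15)" using cap_bounds(2)[OF elim(2)] by simp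
    then have "real (cap n) ^ 2 \<le> (126 * real n powr (1/15)) ^ 2" by (intro power_mono) auto
    also have "\<dots> = 126\<^sup>2 * real n powr (2/15)" using n by (simp add: power_mult_distrib powr_power)
    finally have X2: "real (cap n) ^ 2 \<le> 126\<^sup>2 * real n powr (2/15)" .
    have "(50 * real (cap n) ^ 2 * max 1 d) ^ 7 \<le> (50 * (126\<^sup>2 * real n powr (2/15)) * max 1 d) ^ 7"
      using X2 by (intro power_mono mult_right_mono mult_left_mono) auto
    also have "\<dots> = c * (real n powr (2/15)) ^ 7" by (simp add: c_def power_mult_distrib)
    also have "\<dots> = c * real n powr (14/15)" using n by (simp add: powr_power)
    finally have "(50 * real (cap n) ^ 2 * max 1 d) ^ 7 / real n \<le> c * real n powr (14/15) / real n"
      using n by (intro divide_right_mono) auto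
    then have le: "(50 * real (cap n) ^ 2 * max 1 d) ^ 7 / real n \<le> real n powr (-1/20)" using elim(1) by linarith
    have "measure_pmf.prob (gnp n (d / real n)) {E. has_excess (cap n) E}
        \<le> ((50 * real (cap n) ^ 2 * max 1 d) ^ 7 / real n) ^ cap n"
      using d_pos n cap_bounds(3)[OF elim(2)] by (intro prob_excess_le) auto
    also have "\<dots> \<le> (real n powr (-1/20)) ^ cap n" using le n by (intro power_mono) auto
    also have "\<dots> = exp (- (real (cap n) * (ln (real n) / 20)))" using n
      by (simp add: powr_def exp_of_nat_mult[symmetric])
    also have "\<dots> \<le> exp (- (20 * (w n)\<^sup>2 * (ln (real n) / 20)))"
    proof -
      have "20 * (w n)\<^sup>2 * (ln (real n) / 20) \<le> real (cap n) * (ln (real n) / 20)"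
        using cap_bounds(1)[OF elim(2)] n by (intro mult_right_mono) auto
      then show ?thesis by simp
    qed
    also have "\<dots> = exp (- 2 * U n)" by (simp add: clique_cost_def)
    finally show ?case .
  qed
qed

text \<open>The cap at \<open>1\<close> is there because triangles of \<open>H\<close> beyond \<open>k\<close> save nothing on disjoint triangles.\<close>

definition share :: "nat \<Rightarrow> nat set set \<Rightarrow> real" where
  "share n H = min 1 (real (card (triangles H UNIV)) / real (k n))"

text \<open>The cores whose cost exceeds the cheapest cost by a constant proportion of \<open>U\<close>. The parameter \<open>L\<close> is a
lower bound for \<open>k ln k / U\<close>. The bound on the vertices comes from \<open>few_vertices_if_edges_heavy\<close> with
at most \<open>126 w\<^sup>2\<close> edges and \<open>h = \<epsilon>' w / 756\<close>, as \<open>190512 = 2 * 126 * 756\<close>.\<close>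

definition cores :: "real \<Rightarrow> real \<Rightarrow> nat \<Rightarrow> nat set set set" where
  "cores \<epsilon>' L n = {H. H \<subseteq> pairs {..<n} \<and> card (\<Union>H) \<le> nat \<lfloor>190512 / \<epsilon>' * w n\<rfloor> \<and> card H \<le> 6 * cap n \<and>
     min_cost n + 2 * \<epsilon>' * U n \<le> real (card H) * ln (real n) + L * (1 - share n H - 2 * \<epsilon>') * U n}"

text \<open>Disjoint triangles must make up for what the core \<open>H\<close> lacks, up to the proportion \<open>\<epsilon>'\<close> lost by
pruning; \<open>nat\<close> turns a negative number into \<open>0\<close>.\<close>

definition missing :: "real \<Rightarrow> nat \<Rightarrow> nat set set \<Rightarrow> nat" where
  "missing \<epsilon>' n H = nat \<lceil>(1 - \<epsilon>') * real (k n) - real (card (triangles H UNIV))\<rceil>"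

lemma prob_core_term:
  assumes e: "0 < \<epsilon>'" "\<epsilon>' < 1" and K: "exp 1 * (d ^ 3 / 6) / \<epsilon>' \<le> real (k n) powr \<epsilon>'" "1 \<le> k n"
    and L: "0 \<le> L * U n" "L * U n \<le> real (k n) * ln (real (k n))"
    and n: "1 \<le> real n" and H: "H \<in> cores \<epsilon>' L n"
  shows "(d / real n) ^ card H * ((d ^ 3 / 6) ^ missing \<epsilon>' n H / fact (missing \<epsilon>' n H))
    \<le> exp (126 * (w n)\<^sup>2 * ln (max 1 d) + d ^ 3 / 6 - (min_cost n + 2 * \<epsilon>' * U n))"
proof -
  have "(1 - share n H - \<epsilon>') * real (k n) \<le> real (missing \<epsilon>' n H)"
  proof (cases "real (card (triangles H UNIV)) \<le> real (k n)")
    case True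
    then have "share n H * real (k n) = real (card (triangles H UNIV))" using K(2) by (simp add: share_def min_def)
    then have "(1 - share n H - \<epsilon>') * real (k n) = (1 - \<epsilon>') * real (k n) - real (card (triangles H UNIV))"
      by (simp add: algebra_simps)
    then show ?thesis unfolding missing_def by linarith
  next
    case False
    then have "share n H = 1" using K(2) by (simp add: share_def min_def)
    then have "(1 - share n H - \<epsilon>') * real (k n) \<le> 0" using e by (simp add: mult_nonpos_nonneg)
    then show ?thesis by linarith
  qed
  then have 1: "(d ^ 3 / 6) ^ missing \<epsilon>' n H / fact (missing \<epsilon>' n H) \<le> exp (d ^ 3 / 6 - (1 - share n H - 2 * \<epsilon>') * (L * U n))"
    using e K L d_pos by (intro power_over_fact_le_cost[where \<epsilon>' = \<epsilon>' and K = "real (k n)"]) (auto simp: share_def)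
  have "card H \<le> 6 * cap n" using H by (simp add: cores_def)
  then have cH: "real (card H) \<le> 126 * (w n)\<^sup>2" using cap_bounds(2)[OF K(2)] by linarith
  have "(d / real n) ^ card H \<le> (max 1 d / real n) ^ card H"
    using d_pos n by (intro power_mono divide_right_mono) auto
  also have "max 1 d / real n = exp (ln (max 1 d) - ln (real n))" using n by (simp add: exp_diff)
  also have "exp (ln (max 1 d) - ln (real n)) ^ card H = exp (real (card H) * ln (max 1 d) - real (card H) * ln (real n))"
    by (simp add: exp_of_nat_mult[symmetric] algebra_simps)
  also have "\<dots> \<le> exp (126 * (w n)\<^sup>2 * ln (max 1 d) - real (card H) * ln (real n))"
    using cH by (simp add: mult_right_mono)
  finally have "(d / real n) ^ card H * ((d ^ 3 / 6) ^ missing \<epsilon>' n H / fact (missing \<epsilon>' n H))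
      \<le> exp (126 * (w n)\<^sup>2 * ln (max 1 d) - real (card H) * ln (real n)) * exp (d ^ 3 / 6 - (1 - share n H - 2 * \<epsilon>') * (L * U n))"
    using 1 d_pos by (intro mult_mono) auto
  also have "\<dots> = exp (126 * (w n)\<^sup>2 * ln (max 1 d) + d ^ 3 / 6 - (real (card H) * ln (real n) + L * (1 - share n H - 2 * \<epsilon>') * U n))"
    by (simp add: exp_add[symmetric] algebra_simps)
  also have "\<dots> \<le> exp (126 * (w n)\<^sup>2 * ln (max 1 d) + d ^ 3 / 6 - (min_cost n + 2 * \<epsilon>' * U n))"
    using H by (simp add: cores_def)
  finally show ?thesis .
qed

text \<open>A core is determined by its \<open>O(w)\<close> vertices and a set of pairs among them, so the number of cores is
\<open>exp (O(w ln n + w\<^sup>2))\<close>, which \<open>absorb\<close> bounds by \<open>exp (\<epsilon>' U)\<close>. It is the bound on the vertices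
that makes the entropy negligible even when \<open>k\<close> is a power of \<open>n\<close>.\<close>

lemma prob_cores_le:
  assumes e: "0 < \<epsilon>'" "\<epsilon>' < 1"
    and L: "\<forall>\<^sub>F n in sequentially. 0 \<le> L n \<and> L n * U n \<le> real (k n) * ln (real (k n))"
  shows "\<forall>\<^sub>F n in sequentially. measure_pmf.prob (gnp n (d / real n)) {E. core_event (cores \<epsilon>' (L n) n) (missing \<epsilon>' n) E}
    \<le> exp (- (min_cost n + \<epsilon>' * U n))"
proof -
  define C where "C = 190512 / \<epsilon>'"
  have C: "0 < C" using e by (simp add: C_def)
  define a where "a = exp 1 * (d ^ 3 / 6) / \<epsilon>'"
  have "filterlim (\<lambda>x::real. x powr \<epsilon>') at_top at_top" using e by real_asymp
  from filterlim_compose[OF this real_k_top] have "\<forall>\<^sub>F n in sequentially. a \<le> real (k n) powr \<epsilon>'" unfolding filterlim_at_top by blast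
  then show ?thesis
    using absorb[OF e(1), of "2 * C" "C\<^sup>2 + 126 * ln (max 1 d)" "d ^ 3 / 6"] k_ge[of 1] n_ge[of "max 2 d"] L U_pos
  proof eventually_elim
    case (elim n)
    have n: "2 \<le> real n" "d \<le> real n" using elim(4) by auto
    define p where "p = d / real n"
    have p: "0 \<le> p" "p \<le> 1" using d_pos n by (auto simp: p_def)
    define v where "v = nat \<lfloor>C * w n\<rfloor>"
    have w1: "1 \<le> w n" using side_ge_1 elim(3) .
    have v: "real v \<le> C * w n" using C w1 by (simp add: v_def)
    let ?H = "cores \<epsilon>' (L n) n" and ?s = "missing \<epsilon>' n"
    let ?e = "exp (126 * (w n)\<^sup>2 * ln (max 1 d) + d ^ 3 / 6 - (min_cost n + 2 * \<epsilon>' * U n))"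
    have np: "real n * p = d" using n by (simp add: p_def)
    have "measure_pmf.prob (gnp n p) {E. core_event ?H ?s E}
        \<le> (\<Sum>H\<in>?H. p ^ card H * (((real n * p) ^ 3 / 6) ^ ?s H / fact (?s H)))"
      using p by (intro prob_core_event_le) (auto simp: cores_def)
    also have "\<dots> \<le> (\<Sum>H\<in>?H. ?e)"
    proof (rule sum_mono)
      have LU: "0 \<le> L n * U n" "L n * U n \<le> real (k n) * ln (real (k n))" "1 \<le> real n" using elim(5,6) n by auto
      fix H assume "H \<in> ?H"
      from prob_core_term[OF e elim(1)[unfolded a_def] elim(3) LU this]
      show "p ^ card H * (((real n * p) ^ 3 / 6) ^ ?s H / fact (?s H)) \<le> ?e" unfolding np by (simp only: p_def)
    qed
    also have "\<dots> = real (card ?H) * ?e" by simp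
    also have "\<dots> \<le> exp (2 * C * w n * ln (real n) + C\<^sup>2 * (w n)\<^sup>2) * ?e"
    proof (rule mult_right_mono)
      have "card ?H \<le> (n + 1) ^ v * 2 ^ (v\<^sup>2)"
        unfolding cores_def C_def[symmetric] v_def[symmetric]
      proof (rule card_graphs_few_vertices)
        fix A :: "nat set set" and P assume A: "finite A" "card A \<le> v\<^sup>2"
        have "card {H. H \<subseteq> A \<and> P H} \<le> card (Pow A)" using A by (intro card_mono) auto
        also have "\<dots> \<le> 2 ^ (v\<^sup>2)" using A by (simp add: card_Pow)
        finally show "card {H. H \<subseteq> A \<and> P H} \<le> 2 ^ (v\<^sup>2)" .
      qed
      then have "real (card ?H) \<le> real ((n + 1) ^ v * 2 ^ (v\<^sup>2))" by (simp only: of_nat_le_iff)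
      also have "\<dots> = (real n + 1) ^ v * 2 ^ (v\<^sup>2)" by (simp add: add.commute)
      also have "\<dots> \<le> exp (2 * C * w n * ln (real n)) * exp (C\<^sup>2 * (w n)\<^sup>2)"
      proof (rule mult_mono)
        have "2 * real n \<le> real n * real n" using n by (intro mult_right_mono) auto
        then have "real n + 1 \<le> (real n)\<^sup>2" unfolding power2_eq_square using n(1) by linarith
        also have "\<dots> = exp (2 * ln (real n))" using n by (simp add: exp_double)
        finally have "(real n + 1) ^ v \<le> exp (2 * ln (real n)) ^ v" by (intro power_mono) auto
        also have "\<dots> = exp (real v * (2 * ln (real n)))" by (simp add: exp_of_nat_mult)
        also have "\<dots> \<le> exp (C * w n * (2 * ln (real n)))" using v n by (simp add: mult_right_mono)
        finally show "(real n + 1) ^ v \<le> exp (2 * C * w n * ln (real n))" by (simp add: mult.assoc mult.left_commute)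
        have "(2::real) \<le> exp 1" using exp_ge_add_one_self[of 1] by simp
        then have "(2::real) ^ (v\<^sup>2) \<le> exp 1 ^ (v\<^sup>2)" by (intro power_mono) auto
        also have "\<dots> = exp ((real v)\<^sup>2)" by (simp add: exp_of_nat_mult[symmetric])
        also have "\<dots> \<le> exp ((C * w n)\<^sup>2)" using v by (simp add: power_mono)
        finally show "(2::real) ^ (v\<^sup>2) \<le> exp (C\<^sup>2 * (w n)\<^sup>2)" by (simp add: power_mult_distrib)
      qed auto
      finally show "real (card ?H) \<le> exp (2 * C * w n * ln (real n) + C\<^sup>2 * (w n)\<^sup>2)" by (simp add: exp_add)
    qed simp
    also have "\<dots> = exp (2 * C * w n * ln (real n) + (C\<^sup>2 + 126 * ln (max 1 d)) * (w n)\<^sup>2 + d ^ 3 / 6 - (min_cost n + 2 * \<epsilon>' * U n))"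
      by (simp add: exp_add[symmetric] algebra_simps)
    also have "\<dots> \<le> exp (\<epsilon>' * U n - (min_cost n + 2 * \<epsilon>' * U n))" using elim(2) by simp
    also have "\<dots> = exp (- (min_cost n + \<epsilon>' * U n))" by (simp add: algebra_simps)
    finally show ?case by (simp add: p_def)
  qed
qed

text \<open>The deterministic hypothesis, the last one, says that every decomposition of a bad graph into a core
and disjoint triangles is more expensive by \<open>2 \<epsilon>' U\<close> than \<open>many_ge\<close>. Half of this surplus pays for the
number of cores, half of the rest for the error in \<open>many_ge\<close>.\<close>

lemma bad_event_negligible:
  assumes e: "0 < \<epsilon>'" "\<epsilon>' < 1"
    and L: "\<forall>\<^sub>F n in sequentially. 0 \<le> L n \<and> L n * U n \<le> real (k n) * ln (real (k n))"
    and Bad: "\<And>n E. Bad n E \<Longrightarrow> k n \<le> num_triangles E {..<n}"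
    and key: "\<forall>\<^sub>F n in sequentially. \<forall>E H F. E \<subseteq> pairs {..<n} \<and> Bad n E \<and> H \<subseteq> E \<and>
      F \<subseteq> triangles E UNIV \<and> disjoint F \<and>
      (1 - \<epsilon>') * real (k n) \<le> real (card F) + real (card (triangles H UNIV)) \<longrightarrow>
      min_cost n + 2 * \<epsilon>' * U n \<le> real (card H) * ln (real n) + L n * (1 - share n H - 2 * \<epsilon>') * U n"
  shows "(\<lambda>n. measure_pmf.prob (gnp n (d / real n)) {E. Bad n E} / many n) \<longlonglongrightarrow> 0"
proof -
  have half: "0 < \<epsilon>' / 2" using e by simp
  have "\<forall>\<^sub>F n in sequentially. measure_pmf.prob (gnp n (d / real n)) {E. Bad n E} / many n \<le> 2 * exp (- (\<epsilon>' / 2) * U n)"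
    using prob_has_excess_le prob_cores_le[OF e L] key many_ge[OF half] k_ge[of 1] U_pos
  proof eventually_elim
    case prems: (elim n)
    let ?prob = "measure_pmf.prob (gnp n (d / real n))"
    let ?core = "core_event (cores \<epsilon>' (L n) n) (missing \<epsilon>' n)"
    have w1: "1 \<le> w n" using side_ge_1 prems(5) .
    have cover: "has_excess (cap n) E \<or> ?core E" if E: "E \<subseteq> pairs {..<n}" "Bad n E" for E
    proof (cases "has_excess (cap n) E")
      case nd: False
      have gE: "graph E" using graph_of_gnp E(1) .
      \<comment> \<open>Pruning at this level loses at most \<open>126 w\<^sup>2 * h = \<epsilon>' * w ^ 3 / 6 = \<epsilon>' * k\<close> triangles.\<close>
      define h where "h = \<epsilon>' / 756 * w n"
      have h: "0 < h" using e w1 by (simp add: h_def)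
      have cl: "card (\<Union>(pairs ` linked_triangles E)) \<le> 6 * cap n"
      proof (rule ccontr)
        assume "\<not> ?thesis"
        then have "6 * (cap n - 1) < card (\<Union>(pairs ` linked_triangles E))" by simp
        from linked_triangles_excess[OF gE this] have "has_excess (cap n) E"
          using cap_bounds(3)[OF prems(5)] by simp
        then show False using nd by simp
      qed
      obtain H F where HF: "H \<subseteq> E" "card H \<le> 6 * cap n" "h * real (card (\<Union>H)) \<le> 2 * real (card H)"
        "F \<subseteq> triangles E UNIV" "disjoint F" "\<forall>T\<in>F. pairs T \<inter> H = {}"
        "real (card (triangles E UNIV)) \<le> real (card F) + real (card (triangles H UNIV)) + h * real (6 * cap n)"
        by (rule core_and_disjoint_triangles[OF gE less_imp_le[OF h] cl])
      have X126: "real (6 * cap n) \<le> 126 * (w n)\<^sup>2" using cap_bounds(2)[OF prems(5)] by simp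
      have "h * real (6 * cap n) \<le> h * (126 * (w n)\<^sup>2)" using h X126 by (intro mult_left_mono) auto
      also have "\<dots> = \<epsilon>' * (w n ^ 3 / 6)" by (simp add: h_def power2_eq_square power3_eq_cube)
      also have "\<dots> = \<epsilon>' * real (k n)" by (simp add: side_cubed)
      finally have hX: "h * real (6 * cap n) \<le> \<epsilon>' * real (k n)" .
      have "real (k n) \<le> real (card (triangles E UNIV))"
        using Bad[OF E(2)] triangles_in_range[OF E(1)] by (simp add: num_triangles_def)
      then have low: "(1 - \<epsilon>') * real (k n) \<le> real (card F) + real (card (triangles H UNIV))"
        using HF(7) hX by (simp add: algebra_simps)
      have "h * real (card (\<Union>H)) \<le> h * (190512 / \<epsilon>' * w n)"
      proof -
        have "2 * real (card H) \<le> 252 * (w n)\<^sup>2" using HF(2) X126 by linarith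
        also have "\<dots> = h * (190512 / \<epsilon>' * w n)" using e by (simp add: h_def power2_eq_square)
        finally show ?thesis using HF(3) by linarith
      qed
      then have "real (card (\<Union>H)) \<le> 190512 / \<epsilon>' * w n" using h by (rule mult_left_le_imp_le)
      then have v: "card (\<Union>H) \<le> nat \<lfloor>190512 / \<epsilon>' * w n\<rfloor>" by (simp add: le_nat_floor)
      have "min_cost n + 2 * \<epsilon>' * U n \<le> real (card H) * ln (real n) + L n * (1 - share n H - 2 * \<epsilon>') * U n"
        using prems(3) E HF(1,4,5) low by blast
      then have "H \<in> cores \<epsilon>' (L n) n" using v HF(1,2) E(1) by (auto simp: cores_def)
      moreover have "missing \<epsilon>' n H \<le> card F" using low unfolding missing_def by linarith
      then obtain F' where F': "F' \<subseteq> F" "card F' = missing \<epsilon>' n H" by (meson obtain_subset_with_card_n)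
      moreover have "disjoint F'" using HF(5) F'(1) by (rule pairwise_subset)
      ultimately have "?core E" unfolding core_event_def using HF(1,4,6) by blast
      then show ?thesis by simp
    qed simp
    have "?prob {E. Bad n E} \<le> ?prob {E. has_excess (cap n) E \<or> ?core E}"
      using cover by (rule prob_mono_on_graphs)
    also have "\<dots> \<le> ?prob {E. has_excess (cap n) E} + ?prob {E. ?core E}"
      unfolding Collect_disj_eq by (rule measure_Un_le) auto
    also have "\<dots> \<le> exp (- 2 * U n) + exp (- (min_cost n + \<epsilon>' * U n))" using prems(1,2) by (rule add_mono)
    also have "\<dots> \<le> exp (- (min_cost n + \<epsilon>' * U n)) + exp (- (min_cost n + \<epsilon>' * U n))"
    proof (rule add_right_mono)
      have "\<epsilon>' * U n \<le> 1 * U n" using e prems(6) by (intro mult_right_mono) auto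
      then show "exp (- 2 * U n) \<le> exp (- (min_cost n + \<epsilon>' * U n))" by (simp add: min_cost_def)
    qed
    finally have up: "?prob {E. Bad n E} \<le> 2 * exp (- (min_cost n + \<epsilon>' * U n))" by simp
    have lo: "exp (- (min_cost n + \<epsilon>' / 2 * U n)) \<le> many n" using prems(4) e by simp
    have "?prob {E. Bad n E} / many n \<le> 2 * exp (- (min_cost n + \<epsilon>' * U n)) / exp (- (min_cost n + \<epsilon>' / 2 * U n))"
      using up lo by (intro frac_le) auto
    also have "\<dots> = 2 * exp (- (min_cost n + \<epsilon>' * U n) - (- (min_cost n + \<epsilon>' / 2 * U n)))" unfolding exp_diff by simp
    also have "- (min_cost n + \<epsilon>' * U n) - (- (min_cost n + \<epsilon>' / 2 * U n)) = - (\<epsilon>' / 2) * U n" by (simp add: field_simps)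
    finally show ?case .
  qed
  moreover have "(\<lambda>n. 2 * exp (- (\<epsilon>' / 2) * U n)) \<longlonglongrightarrow> 0"
  proof -
    have "((\<lambda>x::real. 2 * exp (- (\<epsilon>' / 2) * x)) \<longlongrightarrow> 0) at_top" using e by real_asymp
    from filterlim_compose[OF this U_top] show ?thesis .
  qed
  ultimately show ?thesis
    by (rule tendsto_sandwich[where f = "\<lambda>_. 0", OF _ _ tendsto_const, rotated]) simp
qed

end

section \<open>Comparing the costs\<close>

text \<open>In the lemmas of this section \<open>\<tau>\<close> is the share of the core, \<open>Q\<close> the cost of its edges and \<open>B\<close> the
cheapest cost, both in units of \<open>U\<close>. Here \<open>\<tau>\<close> is away from \<open>0\<close>, and either away from \<open>1\<close>, where
\<open>concave_gap\<close> gives a surplus of order \<open>\<epsilon> ^ 3\<close>, or the core has too many edges.\<close>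

lemma gap_mixed:
  fixes \<tau> \<epsilon> B Q :: real
  assumes \<epsilon>: "0 < \<epsilon>" "\<epsilon> < 1" and \<tau>: "\<epsilon> / 2 \<le> \<tau>" "\<tau> \<le> 1" and B: "0 \<le> B" "B \<le> 1"
    and Q: "\<tau> powr (2/3) \<le> Q" "1 - \<epsilon>\<^sup>2 / 100 \<le> \<tau> \<Longrightarrow> 1 + \<epsilon>\<^sup>2 / 100 \<le> Q"
  shows "B + 2 * (\<epsilon> ^ 3 / 10000) \<le> Q + B * (1 - \<tau> - 2 * (\<epsilon> ^ 3 / 10000))"
proof -
  define e where "e = \<epsilon> ^ 3 / 10000"
  have e0: "0 < e" using \<epsilon> by (simp add: e_def)
  have "\<epsilon> * \<epsilon>\<^sup>2 \<le> 1 * \<epsilon>\<^sup>2" using \<epsilon> by (intro mult_right_mono) auto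
  then have e1: "100 * e \<le> \<epsilon>\<^sup>2 / 100" by (simp add: e_def power3_eq_cube power2_eq_square)
  have Be: "B * (2 * e) \<le> 2 * e" using B e0 mult_right_mono[of B 1 "2 * e"] by simp
  show ?thesis
  proof (cases "1 - \<epsilon>\<^sup>2 / 100 \<le> \<tau>")
    case True
    have "0 \<le> B * (1 - \<tau>)" using B \<tau> by simp
    then have "- (2 * e) \<le> B * (1 - \<tau> - 2 * e)" using Be by (simp add: right_diff_distrib)
    then show ?thesis using Q(2)[OF True] B e1 e0 unfolding e_def[symmetric] by linarith
  next
    case False
    have "\<epsilon> / 2 * (\<epsilon>\<^sup>2 / 100) \<le> \<tau> * (1 - \<tau>)" using False \<tau> \<epsilon> by (intro mult_mono) auto
    then have "50 * e \<le> \<tau> * (1 - \<tau>)" by (simp add: e_def power3_eq_cube power2_eq_square)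
    then have "\<tau> + 4 * e \<le> Q" using concave_gap[of \<tau>] \<tau> \<epsilon> Q(1) e0 by linarith
    moreover have "B * \<tau> \<le> \<tau>" using B \<tau> \<epsilon> mult_right_mono[of B 1 \<tau>] by simp
    then have "B - \<tau> - 2 * e \<le> B * (1 - \<tau> - 2 * e)" using Be by (simp add: right_diff_distrib)
    ultimately show ?thesis unfolding e_def[symmetric] by linarith
  qed
qed

text \<open>The cost of \<open>k\<close> disjoint triangles is at most \<open>1 - \<rho>\<close> times that of the clique, so moving a share
\<open>\<tau> \<ge> \<epsilon> / 2\<close> into a core costs at least \<open>\<rho> * \<tau>\<close> more.\<close>

lemma gap_disjoint_cheaper:
  fixes \<tau> \<epsilon> B Q \<rho> :: real
  assumes \<epsilon>: "0 < \<epsilon>" and \<rho>: "0 < \<rho>" and \<tau>: "\<epsilon> / 2 \<le> \<tau>" "\<tau> \<le> 1" and B: "0 \<le> B" "B \<le> 1 - \<rho>"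
    and Q: "\<tau> powr (2/3) \<le> Q"
  shows "B + 2 * (\<epsilon> * \<rho> / 8) \<le> Q + B * (1 - \<tau> - 2 * (\<epsilon> * \<rho> / 8))"
proof -
  define e where "e = \<epsilon> * \<rho> / 8"
  have e0: "0 < e" using \<epsilon> \<rho> by (simp add: e_def)
  have "0 \<le> \<tau> * (1 - \<tau>)" using \<tau> \<epsilon> by simp
  then have "\<tau> \<le> Q" using concave_gap[of \<tau>] \<tau> \<epsilon> Q by linarith
  moreover have "\<epsilon> / 2 * \<rho> \<le> \<tau> * (1 - B)" using \<tau> \<epsilon> \<rho> B by (intro mult_mono) auto
  then have "4 * e \<le> \<tau> - B * \<tau>" by (simp add: e_def algebra_simps)
  moreover have "B * (2 * e) \<le> 2 * e" using B \<rho> e0 mult_right_mono[of B 1 "2 * e"] by simp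
  moreover have "B * (1 - \<tau> - 2 * e) = B - B * \<tau> - B * (2 * e)" by (simp add: algebra_simps)
  ultimately show ?thesis unfolding e_def[symmetric] by linarith
qed

text \<open>Now disjoint triangles cost at least \<open>1 + \<rho>\<close> times as much as the clique, so leaving a share
\<open>1 - \<tau> > \<epsilon>\<^sup>2 / 100\<close> of them costs \<open>\<rho> * (1 - \<tau>)\<close> more.\<close>

lemma gap_clique_cheaper:
  fixes \<tau> \<epsilon> B Q \<rho> :: real
  assumes \<epsilon>: "0 < \<epsilon>" "\<epsilon> < 1" and \<rho>: "0 < \<rho>" "\<rho> \<le> 1" and \<tau>: "0 \<le> \<tau>" "\<tau> \<le> 1" and B: "B \<le> 1"
    and Q: "\<tau> powr (2/3) \<le> Q" "1 - \<epsilon>\<^sup>2 / 100 \<le> \<tau> \<Longrightarrow> 1 + \<epsilon>\<^sup>2 / 100 \<le> Q"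
  shows "B + 2 * (\<epsilon>\<^sup>2 / 100 * \<rho> / 8) \<le> Q + (1 + \<rho>) * (1 - \<tau> - 2 * (\<epsilon>\<^sup>2 / 100 * \<rho> / 8))"
proof -
  define e where "e = \<epsilon>\<^sup>2 / 100 * \<rho> / 8"
  have e0: "0 < e" using \<epsilon> \<rho> by (simp add: e_def)
  have e1: "8 * e \<le> \<epsilon>\<^sup>2 / 100" using \<rho> mult_left_mono[of \<rho> 1 "\<epsilon>\<^sup>2 / 100"] by (simp add: e_def mult.commute)
  have re: "(1 + \<rho>) * (2 * e) \<le> 4 * e" using \<rho> e0 mult_right_mono[of "1 + \<rho>" 2 "2 * e"] by simp
  have eq: "(1 + \<rho>) * (1 - \<tau> - 2 * e) = (1 - \<tau>) + \<rho> * (1 - \<tau>) - (1 + \<rho>) * (2 * e)" by (simp add: algebra_simps)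
  have r0: "0 \<le> \<rho> * (1 - \<tau>)" using \<rho> \<tau> by simp
  show ?thesis
  proof (cases "1 - \<epsilon>\<^sup>2 / 100 \<le> \<tau>")
    case True
    then show ?thesis using Q(2) B e1 e0 re eq r0 \<tau> unfolding e_def[symmetric] by linarith
  next
    case False
    have "0 \<le> \<tau> * (1 - \<tau>)" using \<tau> by simp
    then have "\<tau> \<le> Q" using concave_gap[of \<tau>] \<tau> Q by linarith
    moreover have "\<rho> * (\<epsilon>\<^sup>2 / 100) \<le> \<rho> * (1 - \<tau>)" using False \<rho> by (intro mult_left_mono) auto
    then have "8 * e \<le> \<rho> * (1 - \<tau>)" by (simp add: e_def)
    ultimately show ?thesis using B e0 re eq unfolding e_def[symmetric] by linarith
  qed
qed

lemma cond_prob_tendsto_1: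
  fixes M :: "nat \<Rightarrow> 'a pmf"
  assumes pos: "\<forall>\<^sub>F n in sequentially. 0 < measure_pmf.prob (M n) {E. Q n E}"
    and lim: "(\<lambda>n. measure_pmf.prob (M n) {E. \<not> A n E \<and> Q n E} / measure_pmf.prob (M n) {E. Q n E}) \<longlonglongrightarrow> 0"
  shows "(\<lambda>n. \<P>(E in measure_pmf (M n). A n E \<bar> Q n E)) \<longlonglongrightarrow> 1"
proof -
  have "\<forall>\<^sub>F n in sequentially. 1 - measure_pmf.prob (M n) {E. \<not> A n E \<and> Q n E} / measure_pmf.prob (M n) {E. Q n E}
      = \<P>(E in measure_pmf (M n). A n E \<bar> Q n E)"
    using pos
  proof eventually_elim
    case (elim n)
    have "{E. Q n E} = {E. A n E \<and> Q n E} \<union> {E. \<not> A n E \<and> Q n E}" by auto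
    then have "measure_pmf.prob (M n) {E. Q n E} = measure_pmf.prob (M n) {E. A n E \<and> Q n E} + measure_pmf.prob (M n) {E. \<not> A n E \<and> Q n E}"
      by (simp only:) (rule measure_pmf.finite_measure_Union, auto)
    then show ?case using elim by (simp add: cond_prob_def field_simps)
  qed
  moreover have "(\<lambda>n. 1 - measure_pmf.prob (M n) {E. \<not> A n E \<and> Q n E} / measure_pmf.prob (M n) {E. Q n E}) \<longlonglongrightarrow> 1 - 0"
    by (intro tendsto_intros lim)
  ultimately show ?thesis by (simp add: filterlim_cong)
qed

lemma share_ge_of_not_disjoint:
  assumes "E \<subseteq> pairs {..<n}" "\<not> disjoint_event n k \<epsilon> E" "F \<subseteq> triangles E UNIV" "disjoint F"
    "(1 - \<epsilon>') * real k \<le> real (card F) + t" "1 \<le> k"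
  shows "\<epsilon> - \<epsilon>' \<le> t / real k"
proof -
  have "real (card F) < (1 - \<epsilon>) * real k"
    using assms(2-4) triangles_in_range[OF assms(1)] by (auto simp: disjoint_event_def not_le)
  then have "(\<epsilon> - \<epsilon>') * real k \<le> t" using assms(5) by (simp add: algebra_simps)
  then show ?thesis using assms(6) by (simp add: field_simps)
qed

context growing_triangle_count
begin

lemma many_pos: "\<forall>\<^sub>F n in sequentially. 0 < many n"
  using many_ge[OF zero_less_one] by (rule eventually_mono) (erule less_le_trans[OF exp_gt_zero])

lemma share_bounds: "0 \<le> share n H" "share n H \<le> 1"
  by (auto simp: share_def)

lemma edges_ge_share:
  assumes "graph H" "1 \<le> k n" "1 \<le> real n"
  shows "share n H powr (2/3) * U n \<le> real (card H) * ln (real n)"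
proof -
  have "share n H * real (k n) \<le> real (card (triangles H UNIV))"
    using assms(2) by (simp add: share_def min_def field_simps)
  then have "share n H powr (2/3) * ((w n)\<^sup>2 / 2) \<le> real (card H)"
    using assms side_ge_1[OF assms(2)] share_bounds by (intro card_ge_of_triangles) (auto simp: side_cubed)
  then have "share n H powr (2/3) * ((w n)\<^sup>2 / 2) * ln (real n) \<le> real (card H) * ln (real n)"
    using assms(3) by (intro mult_right_mono) auto
  then show ?thesis by (simp add: clique_cost_def mult.assoc)
qed

text \<open>The contrapositive of \<open>cluster_of_few_edges\<close>.\<close>

lemma edges_ge_of_not_cluster:
  assumes "E \<subseteq> pairs {..<n}" "H \<subseteq> E" "\<not> cluster_event n (k n) \<epsilon> E" "0 < \<epsilon>" "\<epsilon> < 1"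
    "1 - \<epsilon>\<^sup>2 / 100 \<le> share n H" "1 \<le> k n" "1 \<le> real n"
  shows "(1 + \<epsilon>\<^sup>2 / 100) * U n \<le> real (card H) * ln (real n)"
proof -
  have gE: "graph E" using graph_of_gnp assms(1) .
  have gH: "graph H" using graph_subset[OF gE assms(2)] .
  have w: "0 < w n" using side_ge_1[OF assms(7)] by simp
  have "(1 + \<epsilon>\<^sup>2 / 100) * (w n)\<^sup>2 < 2 * real (card H)"
  proof (rule ccontr)
    assume "\<not> ?thesis"
    then have few: "2 * real (card H) \<le> (1 + \<epsilon>\<^sup>2 / 100) * (w n)\<^sup>2" by simp
    have "1 - \<epsilon>\<^sup>2 / 100 \<le> real (card (triangles H UNIV)) / real (k n)" using assms(6) by (simp add: share_def)
    then have "(1 - \<epsilon>\<^sup>2 / 100) * real (k n) \<le> real (card (triangles H UNIV))"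
      using assms(7) by (simp add: field_simps)
    then have "(1 - \<epsilon>\<^sup>2 / 100) * (w n ^ 3 / 6) \<le> real (card (triangles H UNIV))" by (simp add: side_cubed)
    from cluster_of_few_edges[OF gH assms(4,5) w few this] obtain V where V: "V \<subseteq> \<Union>H"
      "real (card V) \<le> (1 + \<epsilon>) * w n" "(1 - \<epsilon>) * (w n ^ 3 / 6) \<le> real (card (triangles H V))" .
    have "\<Union>H \<subseteq> {..<n}" using assms(1,2) unfolding pairs_def by blast
    then have "V \<subseteq> {..<n}" using V(1) by blast
    moreover have "real (card V) \<le> (1 + \<epsilon>) * 6 powr (1/3) * real (k n) powr (1/3)"
      using V(2) by (simp add: side_def powr_mult mult.assoc)
    moreover have "card (triangles H V) \<le> num_triangles E V"
      unfolding num_triangles_def using assms(2) by (intro card_mono finite_triangles gE triangles_mono) auto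
    then have "(1 - \<epsilon>) * real (k n) \<le> real (num_triangles E V)" using V(3) by (simp add: side_cubed)
    ultimately have "cluster_event n (k n) \<epsilon> E" unfolding cluster_event_def by blast
    then show False using assms(3) by simp
  qed
  then have "(1 + \<epsilon>\<^sup>2 / 100) * (w n)\<^sup>2 / 2 * ln (real n) \<le> real (card H) * ln (real n)"
    using assms(8) by (intro mult_right_mono) auto
  then show ?thesis by (simp add: clique_cost_def mult.assoc)
qed

text \<open>This is \<open>bad_event_negligible\<close> with all costs divided by \<open>U\<close>.\<close>

lemma conditional_limit:
  assumes e: "0 < \<epsilon>'" "\<epsilon>' < 1"
    and L: "\<forall>\<^sub>F n in sequentially. 0 \<le> L n \<and> L n * U n \<le> real (k n) * ln (real (k n))"
    and key: "\<forall>\<^sub>F n in sequentially. \<forall>E H F. E \<subseteq> pairs {..<n} \<and> \<not> A n E \<and> H \<subseteq> E \<and>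
      F \<subseteq> triangles E UNIV \<and> disjoint F \<and>
      (1 - \<epsilon>') * real (k n) \<le> real (card F) + real (card (triangles H UNIV)) \<longrightarrow>
      min_cost n / U n + 2 * \<epsilon>' \<le> real (card H) * ln (real n) / U n + L n * (1 - share n H - 2 * \<epsilon>')"
  shows "(\<lambda>n. \<P>(E in measure_pmf (gnp n (d / real n)). A n E \<bar> num_triangles E {..<n} \<ge> k n)) \<longlonglongrightarrow> 1"
proof (rule cond_prob_tendsto_1[OF many_pos], rule bad_event_negligible[OF e L])
  show "\<forall>\<^sub>F n in sequentially. \<forall>E H F. E \<subseteq> pairs {..<n} \<and> (\<not> A n E \<and> k n \<le> num_triangles E {..<n}) \<and> H \<subseteq> E \<and>
      F \<subseteq> triangles E UNIV \<and> disjoint F \<and>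
      (1 - \<epsilon>') * real (k n) \<le> real (card F) + real (card (triangles H UNIV)) \<longrightarrow>
      min_cost n + 2 * \<epsilon>' * U n \<le> real (card H) * ln (real n) + L n * (1 - share n H - 2 * \<epsilon>') * U n"
    using key U_pos
  proof eventually_elim
    case (elim n)
    show ?case
    proof (intro allI impI, elim conjE)
      fix E H F assume *: "E \<subseteq> pairs {..<n}" "\<not> A n E" "H \<subseteq> E" "F \<subseteq> triangles E UNIV" "disjoint F"
        "(1 - \<epsilon>') * real (k n) \<le> real (card F) + real (card (triangles H UNIV))"
      then have "min_cost n / U n + 2 * \<epsilon>' \<le> real (card H) * ln (real n) / U n + L n * (1 - share n H - 2 * \<epsilon>')"
        using elim(1) by blast
      then have "(min_cost n / U n + 2 * \<epsilon>') * U n \<le> (real (card H) * ln (real n) / U n + L n * (1 - share n H - 2 * \<epsilon>')) * U n"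
        using elim(2) by (intro mult_right_mono) auto
      then show "min_cost n + 2 * \<epsilon>' * U n \<le> real (card H) * ln (real n) + L n * (1 - share n H - 2 * \<epsilon>') * U n"
        using elim(2) by (simp add: distrib_right)
    qed
  qed
qed simp

lemma min_cost_bounds:
  "\<forall>\<^sub>F n in sequentially. 0 < U n \<and> 1 \<le> k n \<and> 1 \<le> real n \<and> 0 \<le> min_cost n / U n \<and> min_cost n / U n \<le> 1 \<and> min_cost n / U n * U n \<le> real (k n) * ln (real (k n))"
  using U_pos k_ge[of 1] n_ge[of 1]
proof eventually_elim
  case (elim n)
  have "0 \<le> real (k n) * ln (real (k n))" using elim by simp
  then have "0 \<le> min_cost n" "min_cost n \<le> U n" "min_cost n \<le> real (k n) * ln (real (k n))" using elim by (auto simp: min_cost_def)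
  then show ?case using elim by (auto simp: field_simps)
qed

lemma disjoint_or_cluster_limit:
  assumes \<epsilon>: "0 < \<epsilon>" "\<epsilon> < 1"
  shows "(\<lambda>n. \<P>(E in measure_pmf (gnp n (d / real n)).
     disjoint_event n (k n) \<epsilon> E \<or> cluster_event n (k n) \<epsilon> E \<bar> num_triangles E {..<n} \<ge> k n)) \<longlonglongrightarrow> 1"
proof (rule conditional_limit[of "\<epsilon> ^ 3 / 10000" "\<lambda>n. min_cost n / U n"])
  have e3: "\<epsilon> ^ 3 \<le> \<epsilon>" using \<epsilon> power_decreasing[of 1 3 \<epsilon>] by simp
  show "0 < \<epsilon> ^ 3 / 10000" "\<epsilon> ^ 3 / 10000 < 1" using \<epsilon> e3 by auto
  show "\<forall>\<^sub>F n in sequentially. 0 \<le> min_cost n / U n \<and> min_cost n / U n * U n \<le> real (k n) * ln (real (k n))"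
    using min_cost_bounds by (rule eventually_mono) blast
  show "\<forall>\<^sub>F n in sequentially. \<forall>E H F. E \<subseteq> pairs {..<n} \<and> \<not> (disjoint_event n (k n) \<epsilon> E \<or> cluster_event n (k n) \<epsilon> E) \<and> H \<subseteq> E \<and>
      F \<subseteq> triangles E UNIV \<and> disjoint F \<and>
      (1 - \<epsilon> ^ 3 / 10000) * real (k n) \<le> real (card F) + real (card (triangles H UNIV)) \<longrightarrow>
      min_cost n / U n + 2 * (\<epsilon> ^ 3 / 10000) \<le> real (card H) * ln (real n) / U n + min_cost n / U n * (1 - share n H - 2 * (\<epsilon> ^ 3 / 10000))"
    using min_cost_bounds
  proof eventually_elim
    case (elim n)
    show ?case
    proof (intro allI impI, elim conjE, rule gap_mixed[OF \<epsilon>])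
      fix E H F assume E: "E \<subseteq> pairs {..<n}" "\<not> (disjoint_event n (k n) \<epsilon> E \<or> cluster_event n (k n) \<epsilon> E)"
        and H: "H \<subseteq> E" and F: "F \<subseteq> triangles E UNIV" "disjoint F"
        "(1 - \<epsilon> ^ 3 / 10000) * real (k n) \<le> real (card F) + real (card (triangles H UNIV))"
      have gH: "graph H" using graph_subset[OF graph_of_gnp[OF E(1)] H] .
      have "\<epsilon> - \<epsilon> ^ 3 / 10000 \<le> real (card (triangles H UNIV)) / real (k n)"
        using E F elim by (intro share_ge_of_not_disjoint[where F = F and E = E and n = n]) auto
      then show "\<epsilon> / 2 \<le> share n H" unfolding share_def using \<epsilon> e3 by simp
      show "share n H powr (2/3) \<le> real (card H) * ln (real n) / U n"
        using edges_ge_share[OF gH, of n] elim by (simp add: pos_le_divide_eq)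
      show "1 + \<epsilon>\<^sup>2 / 100 \<le> real (card H) * ln (real n) / U n" if "1 - \<epsilon>\<^sup>2 / 100 \<le> share n H"
        using edges_ge_of_not_cluster[OF E(1) H _ \<epsilon> that] E(2) elim by (simp add: pos_le_divide_eq)
    qed (use elim share_bounds in auto)
  qed
qed

lemma disjoint_limit:
  assumes \<epsilon>: "0 < \<epsilon>" "\<epsilon> < 1" and \<rho>: "0 < \<rho>" "\<rho> < 1"
    and regime: "\<forall>\<^sub>F n in sequentially. real (k n) * ln (real (k n)) \<le> (1 - \<rho>) * U n"
  shows "(\<lambda>n. \<P>(E in measure_pmf (gnp n (d / real n)).
     disjoint_event n (k n) \<epsilon> E \<bar> num_triangles E {..<n} \<ge> k n)) \<longlonglongrightarrow> 1"
proof (rule conditional_limit[of "\<epsilon> * \<rho> / 8" "\<lambda>n. min_cost n / U n"])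
  have e\<rho>: "\<epsilon> * \<rho> < \<epsilon>" using \<epsilon> \<rho> by simp
  show "0 < \<epsilon> * \<rho> / 8" using \<epsilon> \<rho> by simp
  show "\<epsilon> * \<rho> / 8 < 1" using \<epsilon> e\<rho> by linarith
  show "\<forall>\<^sub>F n in sequentially. 0 \<le> min_cost n / U n \<and> min_cost n / U n * U n \<le> real (k n) * ln (real (k n))"
    using min_cost_bounds by (rule eventually_mono) blast
  show "\<forall>\<^sub>F n in sequentially. \<forall>E H F. E \<subseteq> pairs {..<n} \<and> \<not> disjoint_event n (k n) \<epsilon> E \<and> H \<subseteq> E \<and>
      F \<subseteq> triangles E UNIV \<and> disjoint F \<and>
      (1 - \<epsilon> * \<rho> / 8) * real (k n) \<le> real (card F) + real (card (triangles H UNIV)) \<longrightarrow>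
      min_cost n / U n + 2 * (\<epsilon> * \<rho> / 8) \<le> real (card H) * ln (real n) / U n + min_cost n / U n * (1 - share n H - 2 * (\<epsilon> * \<rho> / 8))"
    using min_cost_bounds regime
  proof eventually_elim
    case (elim n)
    show ?case
    proof (intro allI impI, elim conjE, rule gap_disjoint_cheaper[OF \<epsilon>(1) \<rho>(1)])
      fix E H F assume E: "E \<subseteq> pairs {..<n}" "\<not> disjoint_event n (k n) \<epsilon> E"
        and H: "H \<subseteq> E" and F: "F \<subseteq> triangles E UNIV" "disjoint F"
        "(1 - \<epsilon> * \<rho> / 8) * real (k n) \<le> real (card F) + real (card (triangles H UNIV))"
      have gH: "graph H" using graph_subset[OF graph_of_gnp[OF E(1)] H] .
      have "\<epsilon> - \<epsilon> * \<rho> / 8 \<le> real (card (triangles H UNIV)) / real (k n)"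
        using E F elim by (intro share_ge_of_not_disjoint[where F = F and E = E and n = n]) auto
      then show "\<epsilon> / 2 \<le> share n H" unfolding share_def using \<epsilon> e\<rho> by (intro min.boundedI) linarith+
      show "share n H powr (2/3) \<le> real (card H) * ln (real n) / U n"
        using edges_ge_share[OF gH, of n] elim by (simp add: pos_le_divide_eq)
      show "min_cost n / U n \<le> 1 - \<rho>" using elim by (simp add: min_cost_def pos_divide_le_eq)
    qed (use elim share_bounds in auto)
  qed
qed

lemma cluster_limit:
  assumes \<epsilon>: "0 < \<epsilon>" "\<epsilon> < 1" and \<rho>: "0 < \<rho>" "\<rho> < 1"
    and regime: "\<forall>\<^sub>F n in sequentially. (1 + \<rho>) * U n \<le> real (k n) * ln (real (k n))"
  shows "(\<lambda>n. \<P>(E in measure_pmf (gnp n (d / real n)).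
     cluster_event n (k n) \<epsilon> E \<bar> num_triangles E {..<n} \<ge> k n)) \<longlonglongrightarrow> 1"
proof (rule conditional_limit[of "\<epsilon>\<^sup>2 / 100 * \<rho> / 8" "\<lambda>n. 1 + \<rho>"])
  have "\<epsilon>\<^sup>2 * \<rho> \<le> 1 * 1" using \<epsilon> \<rho> by (intro mult_mono power_le_one) auto
  then show "0 < \<epsilon>\<^sup>2 / 100 * \<rho> / 8" "\<epsilon>\<^sup>2 / 100 * \<rho> / 8 < 1" using \<epsilon> \<rho> by auto
  show "\<forall>\<^sub>F n in sequentially. 0 \<le> 1 + \<rho> \<and> (1 + \<rho>) * U n \<le> real (k n) * ln (real (k n))"
    using regime by (rule eventually_mono) (use \<rho> in auto)
  show "\<forall>\<^sub>F n in sequentially. \<forall>E H F. E \<subseteq> pairs {..<n} \<and> \<not> cluster_event n (k n) \<epsilon> E \<and> H \<subseteq> E \<and>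
      F \<subseteq> triangles E UNIV \<and> disjoint F \<and>
      (1 - \<epsilon>\<^sup>2 / 100 * \<rho> / 8) * real (k n) \<le> real (card F) + real (card (triangles H UNIV)) \<longrightarrow>
      min_cost n / U n + 2 * (\<epsilon>\<^sup>2 / 100 * \<rho> / 8) \<le> real (card H) * ln (real n) / U n + (1 + \<rho>) * (1 - share n H - 2 * (\<epsilon>\<^sup>2 / 100 * \<rho> / 8))"
    using min_cost_bounds
  proof eventually_elim
    case (elim n)
    show ?case
    proof (intro allI impI, elim conjE, rule gap_clique_cheaper[OF \<epsilon> \<rho>(1) less_imp_le[OF \<rho>(2)]])
      fix E H F assume E: "E \<subseteq> pairs {..<n}" "\<not> cluster_event n (k n) \<epsilon> E" and H: "H \<subseteq> E"
      have gH: "graph H" using graph_subset[OF graph_of_gnp[OF E(1)] H] .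
      show "share n H powr (2/3) \<le> real (card H) * ln (real n) / U n"
        using edges_ge_share[OF gH, of n] elim by (simp add: pos_le_divide_eq)
      show "1 + \<epsilon>\<^sup>2 / 100 \<le> real (card H) * ln (real n) / U n" if "1 - \<epsilon>\<^sup>2 / 100 \<le> share n H"
        using edges_ge_of_not_cluster[OF E(1) H E(2) \<epsilon> that] elim by (simp add: pos_le_divide_eq)
    qed (use elim share_bounds in auto)
  qed
qed

end

section \<open>Eventually constant triangle counts\<close>

text \<open>Without linked triangles all triangles are disjoint, so \<open>N \<ge> k\<close> already yields the disjoint family. Linked
triangles need excess \<open>1\<close> and have probability \<open>O(1 / n)\<close>.\<close>

lemma bounded_disjoint_negligible:
  assumes d: "0 < d" and \<epsilon>: "0 < \<epsilon>" and const: "\<forall>\<^sub>F n in sequentially. k n = c"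
  shows "\<forall>\<^sub>F n in sequentially. 0 < measure_pmf.prob (gnp n (d / real n)) {E. k n \<le> num_triangles E {..<n}}" (is ?pos)
    and "(\<lambda>n. measure_pmf.prob (gnp n (d / real n)) {E. \<not> disjoint_event n (k n) \<epsilon> E \<and> k n \<le> num_triangles E {..<n}}
      / measure_pmf.prob (gnp n (d / real n)) {E. k n \<le> num_triangles E {..<n}}) \<longlonglongrightarrow> 0" (is ?lim)
proof -
  let ?many = "\<lambda>n. measure_pmf.prob (gnp n (d / real n)) {E. k n \<le> num_triangles E {..<n}}"
  let ?bad = "\<lambda>n. measure_pmf.prob (gnp n (d / real n)) {E. \<not> disjoint_event n (k n) \<epsilon> E \<and> k n \<le> num_triangles E {..<n}}"
  have "filterlim (\<lambda>n::nat. real n powr (1/10)) at_top sequentially" by real_asymp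
  then have "\<forall>\<^sub>F n::nat in sequentially. real c \<le> real n powr (1/10)" unfolding filterlim_at_top by blast
  then have "\<forall>\<^sub>F n in sequentially. real (k n) \<le> real n powr (1/10)"
    using const by eventually_elim simp
  from eventually_prob_disjoint_ge[OF d this] obtain x where x: "0 < x"
    and ev: "\<forall>\<^sub>F n in sequentially. x ^ k n / (2 * fact (k n)) \<le> ?many n" by blast
  define y where "y = x ^ c / (2 * fact c)"
  have y: "0 < y" using x by (simp add: y_def)
  have many: "\<forall>\<^sub>F n in sequentially. y \<le> ?many n" using ev const by eventually_elim (simp add: y_def)
  then show ?pos by (rule eventually_mono) (use y in auto)
  define a where "a = (50 * max 1 d) ^ 7"
  have "\<forall>\<^sub>F n::nat in sequentially. d \<le> real n"
    using filterlim_real_sequentially unfolding filterlim_at_top by blast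
  with many have "\<forall>\<^sub>F n in sequentially. ?bad n / ?many n \<le> a / y * (1 / real n)"
  proof eventually_elim
    case (elim n)
    have "?bad n \<le> measure_pmf.prob (gnp n (d / real n)) {E. has_excess 1 E}"
    proof (rule prob_mono_on_graphs, elim conjE)
      fix E assume E: "E \<subseteq> pairs {..<n}" "\<not> disjoint_event n (k n) \<epsilon> E" "k n \<le> num_triangles E {..<n}"
      show "has_excess 1 E"
      proof (rule ccontr)
        assume no: "\<not> ?thesis"
        have "card (\<Union>(pairs ` linked_triangles E)) = 0"
        proof (rule ccontr)
          assume "\<not> ?thesis"
          then have "6 * 0 < card (\<Union>(pairs ` linked_triangles E))" by simp
          from linked_triangles_excess[OF graph_of_gnp[OF E(1)] this] show False using no by simp
        qed
        moreover have "\<Union>(pairs ` linked_triangles E) \<subseteq> E"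
          by (auto simp: linked_triangles_def triangles_iff)
        ultimately have "\<Union>(pairs ` linked_triangles E) = {}"
          using finite_subset graph_finite[OF graph_of_gnp[OF E(1)]] by (auto simp: card_eq_0_iff)
        moreover have "pairs T \<noteq> {}" if "T \<in> linked_triangles E" for T
          using that card_pairs_3[of T] by (auto simp: linked_triangles_def triangles_iff)
        ultimately have "linked_triangles E = {}" by blast
        then have "disjoint (triangles E {..<n})"
          using isolated_triangles_disjoint[of E] triangles_in_range[OF E(1)] by simp
        moreover have "(1 - \<epsilon>) * real (k n) \<le> 1 * real (k n)" using \<epsilon> by (intro mult_right_mono) auto
        then have "(1 - \<epsilon>) * real (k n) \<le> real (card (triangles E {..<n}))"
          using E(3) by (simp add: num_triangles_def)
        ultimately show False using E(2) by (auto simp: disjoint_event_def)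
      qed
    qed
    also have "\<dots> \<le> ((50 * real 1 ^ 2 * max 1 d) ^ 7 / real n) ^ 1"
      using d elim(2) by (intro prob_excess_le) auto
    finally have "?bad n \<le> a / real n" by (simp add: a_def)
    then have "?bad n / ?many n \<le> (a / real n) / y" using elim(1) y by (intro frac_le) (auto simp: a_def)
    then show ?case by (simp add: mult.commute)
  qed
  moreover have "(\<lambda>n. a / y * (1 / real n)) \<longlonglongrightarrow> 0"
    using tendsto_mult[OF tendsto_const lim_1_over_n, of "a / y"] by simp
  ultimately show ?lim
    by (rule tendsto_sandwich[where f = "\<lambda>_. 0", OF _ _ tendsto_const, rotated]) simp
qed

lemma nat_mono_cases:
  fixes k :: "nat \<Rightarrow> nat" assumes "mono k"
  obtains (const) c where "\<forall>\<^sub>F n in sequentially. k n = c" | (top) "filterlim k at_top sequentially"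
proof (cases "\<exists>Z. \<forall>n. k n < Z")
  case True
  then have fin: "finite (range k)" by (auto intro: finite_subset[of _ "{..<Z}" for Z])
  have "Max (range k) \<in> range k" using fin by (intro Max_in) auto
  then obtain N where N: "k N = Max (range k)" by auto
  have "k n = k N" if "N \<le> n" for n
    using monoD[OF assms that] N Max_ge[OF fin, of "k n"] by simp
  then show ?thesis using const eventually_sequentially by blast
next
  case False
  have "\<forall>\<^sub>F n in sequentially. Z \<le> k n" for Z
  proof -
    obtain N where "Z \<le> k N" using False by (auto simp: not_less)
    then have "Z \<le> k n" if "N \<le> n" for n using monoD[OF assms that] by simp
    then show ?thesis using eventually_sequentially by blast
  qed
  then show ?thesis using top by (simp add: filterlim_at_top)
qed

section \<open>The threshold\<close>

text \<open>The left side is the form in the theorem, the right side comes from \<open>(6 k)\<^sup>2\<^sup>/\<^sup>3 / 2\<close> edges in a clique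
with \<open>k\<close> triangles.\<close>

lemma critical_constant: "(3 / sqrt 2) powr (2/3) = 6 powr (2/3) / (2::real)"
proof -
  have "((3 / sqrt 2) powr (2/3)) ^ 3 = (6 powr (2/3) / (2::real)) ^ 3"
    by (simp add: powr_power power_divide powr_numeral)
  then show ?thesis by (subst (asm) power_eq_iff_eq_base) auto
qed

lemma critical_constant_gt_1: "1 < (3 / sqrt 2) powr (2/3 :: real)"
proof -
  have "sqrt 2 < sqrt 9" by (rule real_sqrt_less_mono) simp
  then have "1 < 3 / sqrt 2" by simp
  then show ?thesis by (intro gr_one_powr) auto
qed

lemma cost_ratio:
  assumes "0 < m"
  shows "clique_cost n m = (3 / sqrt 2) powr (2/3) * real m powr (2/3) * ln (real n)"
    and "real m * ln (real m) = real m powr (2/3) * (real m powr (1/3) * ln (real m))"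
proof -
  show "clique_cost n m = (3 / sqrt 2) powr (2/3) * real m powr (2/3) * ln (real n)"
    unfolding critical_constant clique_cost_def side_squared by (simp add: powr_mult)
  have "real m powr (2/3) * real m powr (1/3) = real m" using assms by (simp flip: powr_add)
  then show "real m * ln (real m) = real m powr (2/3) * (real m powr (1/3) * ln (real m))" by (simp flip: mult.assoc)
qed

theorem theorem1p2:
  "\<exists>\<delta>0>0. \<forall>(d::real) (\<mu>::real) (k :: nat \<Rightarrow> nat) (\<epsilon>::real).
     0 < d \<and> 0 < \<mu> \<and> \<mu> < 1/10 \<and>
     (\<forall>n. 0 < k n) \<and> mono k \<and>
     (\<forall>\<^sub>F n in sequentially. real (k n) \<le> real n powr (1/10 - \<mu>)) \<and>
     0 < \<epsilon> \<and> \<epsilon> < 1 \<longrightarrow>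
       ((\<lambda>n. \<P>(E in measure_pmf (gnp n (d / real n)).
            disjoint_event n (k n) \<epsilon> E \<or> cluster_event n (k n) \<epsilon> E
              \<bar> num_triangles E {..<n} \<ge> k n)) \<longlonglongrightarrow> 1) \<and>
       (\<forall>\<delta>::real. 0 < \<delta> \<and> \<delta> < \<delta>0 \<longrightarrow>
         ((\<forall>\<^sub>F n in sequentially. real (k n) powr (1/3) * ln (real (k n))
               < ((3 / sqrt 2) powr (2/3) - \<delta>) * ln (real n)) \<longrightarrow>
            (\<lambda>n. \<P>(E in measure_pmf (gnp n (d / real n)).
               disjoint_event n (k n) \<epsilon> E
                 \<bar> num_triangles E {..<n} \<ge> k n)) \<longlonglongrightarrow> 1) \<and>
         ((\<forall>\<^sub>F n in sequentially. real (k n) powr (1/3) * ln (real (k n))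
               > ((3 / sqrt 2) powr (2/3) + \<delta>) * ln (real n)) \<longrightarrow>
            (\<lambda>n. \<P>(E in measure_pmf (gnp n (d / real n)).
               cluster_event n (k n) \<epsilon> E
                 \<bar> num_triangles E {..<n} \<ge> k n)) \<longlonglongrightarrow> 1))"
\<comment> \<open>Any positive bound up to \<open>(3 / sqrt 2) powr (2/3)\<close> would do for \<open>\<delta>\<close>.\<close>
proof (rule exI[of _ 1], rule conjI[OF zero_less_one], intro allI impI, elim conjE)
  fix d \<mu> \<epsilon> :: real and k :: "nat \<Rightarrow> nat"
  assume d: "0 < d" and \<mu>: "0 < \<mu>" and kpos: "\<forall>n. 0 < k n" and mono: "mono k"
    and k\<mu>: "\<forall>\<^sub>F n in sequentially. real (k n) \<le> real n powr (1/10 - \<mu>)"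
    and \<epsilon>: "0 < \<epsilon>" "\<epsilon> < 1"
  let ?P = "\<lambda>A. (\<lambda>n. \<P>(E in measure_pmf (gnp n (d / real n)). A n E \<bar> num_triangles E {..<n} \<ge> k n)) \<longlonglongrightarrow> 1"
  let ?D = "\<lambda>n E. disjoint_event n (k n) \<epsilon> E" and ?C = "\<lambda>n E. cluster_event n (k n) \<epsilon> E"
  define c :: real where "c = (3 / sqrt 2) powr (2/3)"
  have c1: "1 < c" using critical_constant_gt_1 by (simp add: c_def)
  consider (const) m where "\<forall>\<^sub>F n in sequentially. k n = m" | (top) "filterlim k at_top sequentially"
    using nat_mono_cases[OF mono] by metis
  then have "?P (\<lambda>n E. ?D n E \<or> ?C n E) \<and> (\<forall>\<delta>. 0 < \<delta> \<and> \<delta> < 1 \<longrightarrow>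
     ((\<forall>\<^sub>F n in sequentially. real (k n) powr (1/3) * ln (real (k n)) < (c - \<delta>) * ln (real n)) \<longrightarrow> ?P ?D) \<and>
     ((\<forall>\<^sub>F n in sequentially. real (k n) powr (1/3) * ln (real (k n)) > (c + \<delta>) * ln (real n)) \<longrightarrow> ?P ?C))"
  proof cases
    case (const m)
    note bounded = bounded_disjoint_negligible[OF d \<epsilon>(1) const]
    have D: "?P ?D" by (rule cond_prob_tendsto_1[OF bounded])
    have DC: "?P (\<lambda>n E. ?D n E \<or> ?C n E)"
    proof (rule cond_prob_tendsto_1[OF bounded(1)], rule tendsto_sandwich[where f = "\<lambda>_. 0", OF _ _ tendsto_const bounded(2)])
      show "\<forall>\<^sub>F n in sequentially.
          measure_pmf.prob (gnp n (d / real n)) {E. \<not> (?D n E \<or> ?C n E) \<and> k n \<le> num_triangles E {..<n}}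
            / measure_pmf.prob (gnp n (d / real n)) {E. k n \<le> num_triangles E {..<n}}
        \<le> measure_pmf.prob (gnp n (d / real n)) {E. \<not> ?D n E \<and> k n \<le> num_triangles E {..<n}}
            / measure_pmf.prob (gnp n (d / real n)) {E. k n \<le> num_triangles E {..<n}}"
        by (intro always_eventually allI divide_right_mono prob_mono_on_graphs) auto
    qed simp
    have False if \<delta>: "0 < \<delta>" and
      ev: "\<forall>\<^sub>F n in sequentially. real (k n) powr (1/3) * ln (real (k n)) > (c + \<delta>) * ln (real n)" for \<delta>
    proof -
      have "\<forall>\<^sub>F n in sequentially. (real m powr (1/3) * ln (real m)) / (c + \<delta>) \<le> ln (real n)"
        using filterlim_ln_real unfolding filterlim_at_top by blast
      then have "\<forall>\<^sub>F n in sequentially. False"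
        using ev const
      proof eventually_elim
        case (elim n)
        then have "real m powr (1/3) * ln (real m) \<le> ln (real n) * (c + \<delta>)" using c1 \<delta> by (simp add: pos_divide_le_eq)
        then show False using elim(2,3) by (simp add: mult.commute)
      qed
      then show False by simp
    qed
    then show ?thesis using D DC by blast
  next
    case top
    have "\<forall>\<^sub>F n::nat in sequentially. real n powr (1/10 - \<mu>) \<le> real n powr (1/10)"
      using eventually_ge_at_top[of 1] by eventually_elim (use \<mu> in \<open>intro powr_mono, auto\<close>)
    with k\<mu> have "\<forall>\<^sub>F n in sequentially. real (k n) \<le> real n powr (1/10)"
      by eventually_elim linarith
    then interpret growing_triangle_count d k
      using d top by unfold_locales auto
    have D: "?P ?D" if \<delta>: "0 < \<delta>" "\<delta> < 1" and
      ev: "\<forall>\<^sub>F n in sequentially. real (k n) powr (1/3) * ln (real (k n)) < (c - \<delta>) * ln (real n)" for \<delta>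
    proof (rule disjoint_limit[OF \<epsilon>, of "\<delta> / c"])
      show "0 < \<delta> / c" "\<delta> / c < 1" using \<delta> c1 by auto
      show "\<forall>\<^sub>F n in sequentially. real (k n) * ln (real (k n)) \<le> (1 - \<delta> / c) * clique_cost n (k n)"
        using ev
      proof eventually_elim
        case (elim n)
        have "real (k n) * ln (real (k n)) \<le> real (k n) powr (2/3) * ((c - \<delta>) * ln (real n))"
          unfolding cost_ratio(2)[OF kpos[rule_format]] using elim by (intro mult_left_mono) auto
        also have "\<dots> = (1 - \<delta> / c) * clique_cost n (k n)"
          unfolding cost_ratio(1)[OF kpos[rule_format]] c_def[symmetric] using c1 by (simp add: field_simps)
        finally show ?case .
      qed
    qed
    have C: "?P ?C" if \<delta>: "0 < \<delta>" "\<delta> < 1" and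
      ev: "\<forall>\<^sub>F n in sequentially. real (k n) powr (1/3) * ln (real (k n)) > (c + \<delta>) * ln (real n)" for \<delta>
    proof (rule cluster_limit[OF \<epsilon>, of "\<delta> / c"])
      show "0 < \<delta> / c" "\<delta> / c < 1" using \<delta> c1 by auto
      show "\<forall>\<^sub>F n in sequentially. (1 + \<delta> / c) * clique_cost n (k n) \<le> real (k n) * ln (real (k n))"
        using ev
      proof eventually_elim
        case (elim n)
        have "(1 + \<delta> / c) * clique_cost n (k n) = real (k n) powr (2/3) * ((c + \<delta>) * ln (real n))"
          unfolding cost_ratio(1)[OF kpos[rule_format]] c_def[symmetric] using c1 by (simp add: field_simps)
        also have "\<dots> \<le> real (k n) * ln (real (k n))"
          unfolding cost_ratio(2)[OF kpos[rule_format]] using elim by (intro mult_left_mono) auto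
        finally show ?case .
      qed
    qed
    show ?thesis using disjoint_or_cluster_limit[OF \<epsilon>] D C by blast
  qed
  then show "?P (\<lambda>n E. ?D n E \<or> ?C n E) \<and> (\<forall>\<delta>. 0 < \<delta> \<and> \<delta> < 1 \<longrightarrow>
     ((\<forall>\<^sub>F n in sequentially. real (k n) powr (1/3) * ln (real (k n)) < ((3 / sqrt 2) powr (2/3) - \<delta>) * ln (real n)) \<longrightarrow> ?P ?D) \<and>
     ((\<forall>\<^sub>F n in sequentially. real (k n) powr (1/3) * ln (real (k n)) > ((3 / sqrt 2) powr (2/3) + \<delta>) * ln (real n)) \<longrightarrow> ?P ?C))"
    unfolding c_def .
qed

end
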